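(* Consider a $K$-armed stochastic bandit with mean rewards $r(1)>r(2)>\cdots>r(K)$, $a^\star=1$, and features $X\in\mathbb{R}^{K\times d}$, $d\le K$, with rows $x_1,\dots,x_K$. Assume that for all actions $i,j,k\in[K]$ (with $j=k$ allowed) such that $r(i)>r(j)$ and $r(i)>r(k)$, one has $\langle x_i-x_j,\,x_{a^\star}-x_k\rangle>0$ if $i=a^\star$ or $j=k$, and $\langle x_i-x_j,\,x_{a^\star}-x_k\rangle\ge0$ otherwise. Let $\eta>0$ be an arbitrary constant, and let $(\theta_t)_{t\ge1}$ be generated by stochastic softmax policy gradient (defined in the context) with constant learning rate $\eta$. Then almost surely the policies converge to the optimal policy: $\lim_{t\to\infty}\pi_{\theta_t}(a^\star)=1$.
   Context: Bandit: actions $[K]=\{1,\dots,K\}$; each action $a$ has a reward distribution $P_a$ supported in $[-R_{\max},R_{\max}]$ ($R_{\max}>0$; given by a density with respect to a fixed finite measure on that interval) with mean $r(a)$. Policies: $\pi_\theta=\mathrm{softmax}(X\theta)$, i.e. $\pi_\theta(a)=\exp(\langle x_a,\theta\rangle)/\sum_{a'}\exp(\langle x_{a'},\theta\rangle)$. Stochastic softmax policy gradient: start from $\theta_1\in\mathbb{R}^d$; at each $t\ge1$, sample $a_t\sim\pi_{\theta_t}$, observe $R_t(a_t)\sim P_{a_t}$ (given the past and $a_t$), set $\hat r_t(a)=\frac{\mathbf 1\{a=a_t\}}{\pi_{\theta_t}(a)}R_t(a_t)$ for each $a\in[K]$, and $\theta_{t+1}=\theta_t+\eta\,X^\top(\mathrm{diag}(\pi_{\theta_t})-\pi_{\theta_t}\pi_{\theta_t}^\top)\,\hat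 r_t$. *)

theory Defs
  imports "HOL-Probability.Probability"
begin

(* The action set [K] is represented by a finite linearly ordered type 'k with CARD('k) = K;
   its least element is action 1. The feature matrix X :: real^'d^'k has the rows x_a = X $ a. *)

definition first_action :: "'k::{finite,linorder}" where
  "first_action = Min UNIV"

definition softmax :: "real^'k::finite \<Rightarrow> real^'k" where
  "softmax z = (\<chi> a. exp (z $ a) / (\<Sum>b\<in>UNIV. exp (z $ b)))"

definition policy :: "real^'d^'k::finite \<Rightarrow> real^'d \<Rightarrow> real^'k" where
  "policy X \<theta> = softmax (X *v \<theta>)"

definition diag_matrix :: "real^'k::finite \<Rightarrow> real^'k^'k" where
  "diag_matrix v = (\<chi> i j. if i = j then v $ i else 0)"

definition outer_product :: "real^'k::finite \<Rightarrow> real^'k \<Rightarrow> real^'k^'k" where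
  "outer_product v w = (\<chi> i j. v $ i * w $ j)"

definition reward_estimate :: "real^'k::finite \<Rightarrow> 'k \<Rightarrow> real \<Rightarrow> real^'k" where
  "reward_estimate p a \<rho> = (\<chi> b. indicator {a} b / p $ b * \<rho>)"

definition spg_update ::
    "real^'d^'k::finite \<Rightarrow> real \<Rightarrow> real^'d \<Rightarrow> 'k \<Rightarrow> real \<Rightarrow> real^'d" where
  "spg_update X \<eta> \<theta> a \<rho> =
     (let p = policy X \<theta> in
      \<theta> + \<eta> *\<^sub>R (transpose X *v
        ((diag_matrix p - outer_product p p) *v reward_estimate p a \<rho>)))"

(* Measures on the interval [-Rmax, Rmax] are represented as Borel measures on the reals that are
   concentrated on it; \<nu> is the common finite reference measure. *)
definition reward_model ::
    "real \<Rightarrow> real measure \<Rightarrow> ('k \<Rightarrow> real measure) \<Rightarrow> bool" where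
  "reward_model Rmax \<nu> P \<longleftrightarrow>
     finite_measure \<nu> \<and> sets \<nu> = sets borel \<and> emeasure \<nu> (- {-Rmax..Rmax}) = 0 \<and>
     (\<forall>a. prob_space (P a) \<and>
          (\<exists>f. f \<in> borel_measurable borel \<and> (\<forall>x. 0 \<le> f x) \<and>
               P a = density \<nu> (\<lambda>x. ennreal (f x))))"

definition mean_reward :: "('k \<Rightarrow> real measure) \<Rightarrow> 'k \<Rightarrow> real" where
  "mean_reward P a = (\<integral>x. x \<partial>P a)"

definition feature_condition ::
    "('k::{finite,linorder} \<Rightarrow> real) \<Rightarrow> real^'d^'k::{finite,linorder} \<Rightarrow> bool" where
  "feature_condition r X \<longleftrightarrow>
     (\<forall>i j k. r i > r j \<and> r i > r k \<longrightarrow>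
        (if i = first_action \<or> j = k
         then (X $ i - X $ j) \<bullet> (X $ first_action - X $ k) > 0
         else (X $ i - X $ j) \<bullet> (X $ first_action - X $ k) \<ge> 0))"

definition observations ::
    "(nat \<Rightarrow> 'w \<Rightarrow> 'k) \<Rightarrow> (nat \<Rightarrow> 'w \<Rightarrow> real) \<Rightarrow> nat \<Rightarrow> 'w \<Rightarrow> nat \<Rightarrow> 'k \<times> real" where
  "observations act rew t \<omega> = (\<lambda>s\<in>{1..<t}. (act s \<omega>, rew s \<omega>))"

abbreviation observation_space :: "nat \<Rightarrow> (nat \<Rightarrow> 'k \<times> real) measure" where
  "observation_space t \<equiv> (\<Pi>\<^sub>M s\<in>{1..<t}. count_space UNIV \<Otimes>\<^sub>M borel)"

(* The sigma-algebra generated by (a_1, R_1), ..., (a_{t-1}, R_{t-1}); trivial for t = 1. *)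
definition past ::
    "'w measure \<Rightarrow> (nat \<Rightarrow> 'w \<Rightarrow> 'k) \<Rightarrow> (nat \<Rightarrow> 'w \<Rightarrow> real) \<Rightarrow> nat \<Rightarrow> 'w measure" where
  "past M act rew t =
     vimage_algebra (space M) (observations act rew t) (observation_space t)"

(* The sigma-algebra generated by (a_1, R_1), ..., (a_{t-1}, R_{t-1}) and a_t. *)
definition past_action ::
    "'w measure \<Rightarrow> (nat \<Rightarrow> 'w \<Rightarrow> 'k) \<Rightarrow> (nat \<Rightarrow> 'w \<Rightarrow> real) \<Rightarrow> nat \<Rightarrow> 'w measure" where
  "past_action M act rew t =
     vimage_algebra (space M) (\<lambda>\<omega>. (observations act rew t \<omega>, act t \<omega>))
       (observation_space t \<Otimes>\<^sub>M count_space UNIV)"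

(* Time starts at t = 1; the values at index 0 are unconstrained and irrelevant.
   The last two conjuncts are the sampling rules: given the past, a_t has law \<pi>_{\<theta>_t}; given the
   past and a_t, the reward R_t has law P_{a_t}. *)
definition softmax_pg_process ::
    "'w measure \<Rightarrow> ('k::finite \<Rightarrow> real measure) \<Rightarrow> real^'d^'k \<Rightarrow> real \<Rightarrow> real^'d \<Rightarrow>
     (nat \<Rightarrow> 'w \<Rightarrow> 'k) \<Rightarrow> (nat \<Rightarrow> 'w \<Rightarrow> real) \<Rightarrow> (nat \<Rightarrow> 'w \<Rightarrow> real^'d) \<Rightarrow> bool" where
  "softmax_pg_process M P X \<eta> \<theta>\<^sub>1 act rew \<theta> \<longleftrightarrow>
     prob_space M \<and>
     (\<forall>t\<ge>1. act t \<in> measurable M (count_space UNIV)) \<and>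
     (\<forall>t\<ge>1. rew t \<in> borel_measurable M) \<and>
     (\<forall>\<omega>\<in>space M. \<theta> 1 \<omega> = \<theta>\<^sub>1) \<and>
     (\<forall>t\<ge>1. \<forall>\<omega>\<in>space M.
        \<theta> (Suc t) \<omega> = spg_update X \<eta> (\<theta> t \<omega>) (act t \<omega>) (rew t \<omega>)) \<and>
     (\<forall>t\<ge>1. \<forall>a. AE \<omega> in M.
        real_cond_exp M (past M act rew t) (indicator {\<omega> \<in> space M. act t \<omega> = a}) \<omega>
          = policy X (\<theta> t \<omega>) $ a) \<and>
     (\<forall>t\<ge>1. \<forall>B\<in>sets borel. AE \<omega> in M.
        real_cond_exp M (past_action M act rew t) (indicator {\<omega> \<in> space M. rew t \<omega> \<in> B}) \<omega>
          = measure (P (act t \<omega>)) B)"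

(* The conditional expectations above are genuine ones: real_cond_exp M F f is only meaningful
   when F is a subalgebra of M. *)
lemma observations_measurable:
  assumes "\<And>t. t \<ge> 1 \<Longrightarrow> act t \<in> measurable M (count_space UNIV)"
    and "\<And>t. t \<ge> 1 \<Longrightarrow> rew t \<in> borel_measurable M"
  shows "observations act rew t \<in> measurable M (observation_space t)"
  unfolding observations_def using assms
  by (intro measurable_restrict measurable_Pair) auto

lemma subalgebra_vimage_algebra:
  assumes "f \<in> measurable M N"
  shows "subalgebra M (vimage_algebra (space M) f N)"
  unfolding subalgebra_def using sets_image_in_sets[OF refl assms] by simp

lemma subalgebra_past:
  assumes "\<And>t. t \<ge> 1 \<Longrightarrow> act t \<in> measurable M (count_space UNIV)"
    and "\<And>t. t \<ge> 1 \<Longrightarrow> rew t \<in> borel_measurable M"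
  shows "subalgebra M (past M act rew t)"
  unfolding past_def
  by (intro subalgebra_vimage_algebra observations_measurable assms)

lemma subalgebra_past_action:
  assumes "\<And>t. t \<ge> 1 \<Longrightarrow> act t \<in> measurable M (count_space UNIV)"
    and "\<And>t. t \<ge> 1 \<Longrightarrow> rew t \<in> borel_measurable M" and "t \<ge> 1"
  shows "subalgebra M (past_action M act rew t)"
  unfolding past_action_def
  by (intro subalgebra_vimage_algebra measurable_Pair
      observations_measurable assms)

end

theory Submission
  imports Defs
begin

text \<open>Put \<open>D\<^sub>k(t) = \<langle>x\<^sub>1 - x\<^sub>k, \<theta>\<^sub>t\<rangle>\<close>, so that \<open>\<pi>\<^sub>t(k) / \<pi>\<^sub>t(1) = exp (- D\<^sub>k(t))\<close>. With
  \<open>g\<^sub>i\<^sub>j = \<langle>x\<^sub>i - x\<^sub>j, x\<^sub>1 - x\<^sub>k\<rangle>\<close>, the conditional mean of an increment of \<open>D\<^sub>k\<close> is a multiple of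
  \<open>\<Sum> \<pi>(i) \<pi>(j) (r(i) - r(j)) g\<^sub>i\<^sub>j\<close> and its conditional second moment is at most a multiple of
  \<open>\<Sum> \<pi>(i) \<pi>(j) g\<^sub>i\<^sub>j\<^sup>2\<close>. Almost surely the fluctuations of \<open>D\<^sub>k\<close> around its accumulated drift are
  smaller than any multiple of the accumulated variance \<open>V\<close>, up to a random constant; this follows
  from the maximal inequality for exponential supermartingales, for every learning rate.

  The feature condition makes the drift dominate the variance, except for pairs \<open>i, j \<ge> k\<close>.
  Going downwards through \<open>k \<noteq> 1\<close>, one shows that \<open>\<pi>\<^sub>t(k)\<close> is summable or \<open>\<pi>\<^sub>t(k) / \<pi>\<^sub>t(1)\<close> tends to 0:
  the dichotomy for the worse actions turns the bad pairs into a summable error plus a small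
  multiple of \<open>\<pi>(1) (1 - \<pi>(1))\<close>, which the variance absorbs. If \<open>V = \<infinity>\<close> then \<open>D\<^sub>k \<rightarrow> \<infinity>\<close>. If
  \<open>V < \<infinity>\<close> then \<open>D\<^sub>k\<close> stays bounded, so \<open>\<pi>(1)\<close> is comparable to \<open>\<pi>(k)\<close> and stays away from 1, and
  summability of \<open>\<pi>(1) (1 - \<pi>(1))\<close> gives summability of \<open>\<pi>(k)\<close>. Either way \<open>\<pi>\<^sub>t(k) \<rightarrow> 0\<close>.\<close>

section \<open>Concentration of adapted processes around their drift\<close>

text \<open>Stopping at the first passage above a level \<open>a\<close> shows that \<open>a\<close>
  times the probability of a passage is at most the initial mean. Letting time and then the level
  tend to infinity makes the event of passing every level a null set.\<close>

lemma nonneg_supermartingale_AE_bounded: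
  fixes Y :: "nat \<Rightarrow> 'w \<Rightarrow> real"
  assumes "prob_space M"
    and sub: "\<And>t. subalgebra M (F t)"
    and filt: "\<And>t. subalgebra (F (Suc t)) (F t)"
    and meas: "\<And>t. Y t \<in> borel_measurable (F t)"
    and int: "\<And>t. integrable M (Y t)"
    and nonneg: "\<And>t \<omega>. 0 \<le> Y t \<omega>"
    and super: "\<And>t. AE \<omega> in M. real_cond_exp M (F t) (Y (Suc t)) \<omega> \<le> Y t \<omega>"
  shows "AE \<omega> in M. \<exists>K. \<forall>t. Y t \<omega> \<le> K"
proof -
  interpret prob_space M by fact
  \<comment> \<open>\<open>A a t\<close> is the event of no passage up to time \<open>t\<close>. It
    is decided by \<open>F t\<close>, so its indicator can be pulled through the conditional
    expectation.\<close>
  define A where "A = (\<lambda>(a::real) t. {\<omega> \<in> space M. \<forall>s\<le>t. Y s \<omega> < a})"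
  have spF: "space (F t) = space M" for t
    using sub[of t] by (simp add: subalgebra_def)
  have A_Suc: "A a (Suc t) = {\<omega> \<in> A a t. Y (Suc t) \<omega> < a}" for a t
    by (auto simp: A_def le_Suc_eq)
  have A_F: "A a t \<in> sets (F t)" for a t
  proof (induction t)
    case 0
    have "{\<omega> \<in> space (F 0). Y 0 \<omega> < a} \<in> sets (F 0)"
      using meas[of 0] by measurable
    then show ?case by (simp add: A_def spF)
  next
    case (Suc t)
    then have [measurable]: "A a t \<in> sets (F (Suc t))"
      using filt[of t] by (auto simp: subalgebra_def)
    have "{\<omega> \<in> space (F (Suc t)). \<omega> \<in> A a t \<and> Y (Suc t) \<omega> < a} \<in> sets (F (Suc t))"
      using meas[of "Suc t"] by measurable
    moreover have "{\<omega> \<in> space (F (Suc t)). \<omega> \<in> A a t \<and> Y (Suc t) \<omega> < a} = A a (Suc t)"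
      unfolding A_Suc spF by (auto simp: A_def)
    ultimately show ?case by simp
  qed
  then have A_M[measurable]: "A a t \<in> sets M" for a t
    using sub[of t] by (auto simp: subalgebra_def)
  note [measurable] = borel_measurable_integrable[OF int]
  have intA: "integrable M (\<lambda>\<omega>. indicator B \<omega> * Y t \<omega>)" if "B \<in> sets M" for B t
    using integrable_mult_indicator[OF that int[of t]] by simp
  \<comment> \<open>On \<open>B - C\<close> the process is at least \<open>a\<close>, so removing
    \<open>B - C\<close> from the integral costs at least \<open>a\<close> times its
    measure.\<close>
  have drop: "a * measure M (B - C) + (\<integral>\<omega>. indicator C \<omega> * Y t \<omega> \<partial>M)
      \<le> (\<integral>\<omega>. indicator B \<omega> * Y t \<omega> \<partial>M)"
    if [measurable]: "B \<in> sets M" "C \<in> sets M" and C: "C = {\<omega> \<in> B. Y t \<omega> < a}" for B C a t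
  proof -
    have ind: "integrable M (\<lambda>\<omega>. a * indicator (B - C) \<omega>)"
      by (intro integrable_mult_right integrable_real_indicator) (auto simp: less_top[symmetric])
    have "a * measure M (B - C) + (\<integral>\<omega>. indicator C \<omega> * Y t \<omega> \<partial>M)
        = (\<integral>\<omega>. a * indicator (B - C) \<omega> + indicator C \<omega> * Y t \<omega> \<partial>M)"
      by (subst Bochner_Integration.integral_add) (use ind in \<open>auto intro!: intA\<close>)
    also have "\<dots> \<le> (\<integral>\<omega>. indicator B \<omega> * Y t \<omega> \<partial>M)"
      by (intro integral_mono Bochner_Integration.integrable_add intA ind)
        (auto simp: C indicator_def)
    finally show ?thesis .
  qed
  \<comment> \<open>The left side bounds from below the mean of the process stopped at its first
    passage: \<open>a\<close> on the paths that have passed, the current value on the others. It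
    does not increase with \<open>t\<close>.\<close>
  have ville: "a * measure M (space M - A a t) + (\<integral>\<omega>. indicator (A a t) \<omega> * Y t \<omega> \<partial>M)
      \<le> (\<integral>\<omega>. Y 0 \<omega> \<partial>M)" for a t
  proof (induction t)
    case 0
    have "(\<integral>\<omega>. indicator (space M) \<omega> * Y 0 \<omega> \<partial>M) = (\<integral>\<omega>. Y 0 \<omega> \<partial>M)"
      by (intro Bochner_Integration.integral_cong) auto
    with drop[of "space M" "A a 0" 0 a] show ?case by (simp add: A_def)
  next
    case (Suc t)
    interpret S: finite_measure_subalgebra M "F t"
      by unfold_locales (rule sub)
    have ind_F: "indicator (A a t) \<in> borel_measurable (F t)"
      by (rule borel_measurable_indicator[OF A_F])
    have "(\<integral>\<omega>. indicator (A a t) \<omega> * Y (Suc t) \<omega> \<partial>M)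
        = (\<integral>\<omega>. indicator (A a t) \<omega> * real_cond_exp M (F t) (Y (Suc t)) \<omega> \<partial>M)"
      by (rule S.real_cond_exp_intg(2)[OF intA[OF A_M] ind_F, symmetric]) measurable
    also have "\<dots> \<le> (\<integral>\<omega>. indicator (A a t) \<omega> * Y t \<omega> \<partial>M)"
    proof (rule integral_mono_AE)
      show "integrable M (\<lambda>\<omega>. indicator (A a t) \<omega> * real_cond_exp M (F t) (Y (Suc t)) \<omega>)"
        by (rule S.real_cond_exp_intg(1)[OF intA[OF A_M] ind_F]) measurable
      show "AE \<omega> in M. indicator (A a t) \<omega> * real_cond_exp M (F t) (Y (Suc t)) \<omega>
          \<le> indicator (A a t) \<omega> * Y t \<omega>"
        using super[of t] by eventually_elim (auto simp: indicator_def)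
    qed (rule intA[OF A_M])
    finally have le: "(\<integral>\<omega>. indicator (A a t) \<omega> * Y (Suc t) \<omega> \<partial>M)
        \<le> (\<integral>\<omega>. indicator (A a t) \<omega> * Y t \<omega> \<partial>M)" .
    have "measure M (space M - A a (Suc t))
        = measure M (space M - A a t) + measure M (A a t - A a (Suc t))"
      by (subst finite_measure_Union[symmetric])
        (auto simp: A_Suc A_def intro!: arg_cong[where f = "measure M"])
    moreover have "a * measure M (A a t - A a (Suc t))
        + (\<integral>\<omega>. indicator (A a (Suc t)) \<omega> * Y (Suc t) \<omega> \<partial>M)
        \<le> (\<integral>\<omega>. indicator (A a t) \<omega> * Y (Suc t) \<omega> \<partial>M)"
      by (rule drop) (auto simp: A_Suc)
    ultimately show ?case using le Suc by (simp add: algebra_simps)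
  qed
  \<comment> \<open>\<open>U n\<close> is the event that the level \<open>Suc n\<close> is ever
    reached; the successor keeps the level positive.\<close>
  define U where "U = (\<lambda>n::nat. \<Union>t. space M - A (real (Suc n)) t)"
  have U_le: "measure M (U n) \<le> (\<integral>\<omega>. Y 0 \<omega> \<partial>M) / real (Suc n)" for n
  proof -
    have lim: "(\<lambda>t. measure M (space M - A (real (Suc n)) t)) \<longlonglongrightarrow> measure M (U n)"
      unfolding U_def by (intro finite_Lim_measure_incseq) (auto simp: incseq_def A_def)
    moreover have "measure M (space M - A (real (Suc n)) t) \<le> (\<integral>\<omega>. Y 0 \<omega> \<partial>M) / real (Suc n)" for t
    proof -
      have "0 \<le> (\<integral>\<omega>. indicator (A (real (Suc n)) t) \<omega> * Y t \<omega> \<partial>M)"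
        by (intro integral_nonneg_AE) (auto simp: nonneg)
      then have "real (Suc n) * measure M (space M - A (real (Suc n)) t) \<le> (\<integral>\<omega>. Y 0 \<omega> \<partial>M)"
        using ville[of "real (Suc n)" t] by linarith
      then show ?thesis by (simp add: pos_le_divide_eq mult.commute)
    qed
    ultimately show ?thesis by (intro LIMSEQ_le_const2[OF lim]) blast
  qed
  have [measurable]: "U n \<in> sets M" for n
    unfolding U_def by measurable
  have "measure M (\<Inter>n. U n) \<le> (\<integral>\<omega>. Y 0 \<omega> \<partial>M) / real (Suc n)" for n
    by (rule order_trans[OF finite_measure_mono U_le]) auto
  moreover have lim: "(\<lambda>n. (\<integral>\<omega>. Y 0 \<omega> \<partial>M) / real (Suc n)) \<longlonglongrightarrow> 0"
    by (rule LIMSEQ_Suc, rule lim_const_over_n)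
  ultimately have "measure M (\<Inter>n. U n) \<le> 0"
    by (intro LIMSEQ_le_const[OF lim]) blast
  then have "(\<Inter>n. U n) \<in> null_sets M"
    by (auto simp: null_sets_def emeasure_eq_measure measure_le_0_iff)
  then have "AE \<omega> in M. \<omega> \<notin> (\<Inter>n. U n)"
    by (rule AE_not_in)
  with AE_space show ?thesis
  proof eventually_elim
    case (elim \<omega>)
    then obtain n where "\<forall>t. \<omega> \<in> A (real (Suc n)) t"
      by (auto simp: U_def)
    then have "Y t \<omega> < real (Suc n)" for t
      unfolding A_def by blast
    then show ?case by (blast intro: less_imp_le)
  qed
qed

section \<open>Exponential supermartingales and two-sided fluctuation bounds\<close>

text \<open>For positive \<open>y\<close>, (1 + y) (1 - y + y^2) = 1 + y^3 is at least 1, and 1 + y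
  is at most exp y. For the other sign it is the usual quadratic bound of exp on the unit
  interval.\<close>

lemma exp_minus_le_quadratic:
  fixes y :: real
  assumes "\<bar>y\<bar> \<le> 1"
  shows "exp (- y) \<le> 1 - y + y\<^sup>2"
proof (cases "y \<le> 0")
  case True
  then show ?thesis using exp_bound[of "- y"] assms by simp
next
  case False
  have "1 \<le> (1 + y) * (1 - y + y\<^sup>2)"
    using False by (simp add: algebra_simps power2_eq_square)
  also have "\<dots> \<le> exp y * (1 - y + y\<^sup>2)"
  proof (rule mult_right_mono)
    have "0 \<le> (1 - y)\<^sup>2 + y" using False by (intro add_nonneg_nonneg) auto
    then show "0 \<le> 1 - y + y\<^sup>2" by (simp add: power2_eq_square algebra_simps)
  qed simp
  finally show ?thesis by (simp add: exp_minus field_simps)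
qed

text \<open>Multiplying \<open>exp (- \<kappa> D)\<close> by the compensator below makes it a supermartingale because
  \<open>exp (- y) \<le> 1 - y + y\<^sup>2\<close>.\<close>

lemma AE_drift_lower_bound:
  fixes D \<mu> v :: "nat \<Rightarrow> 'w \<Rightarrow> real"
  assumes "prob_space M"
    and sub: "\<And>t. subalgebra M (F t)"
    and filt: "\<And>t. subalgebra (F (Suc t)) (F t)"
    and D: "\<And>t. D t \<in> borel_measurable (F t)"
    and \<mu>: "\<And>t. \<mu> t \<in> borel_measurable (F t)"
    and v: "\<And>t. v t \<in> borel_measurable (F t)"
    and bound: "\<And>t. AE \<omega> in M. \<bar>D (Suc t) \<omega> - D t \<omega>\<bar> \<le> B"
    and \<mu>_bound: "\<And>t \<omega>. \<bar>\<mu> t \<omega>\<bar> \<le> C"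
    and v_nonneg: "\<And>t \<omega>. 0 \<le> v t \<omega>"
    and first: "\<And>t. AE \<omega> in M. real_cond_exp M (F t) (\<lambda>\<omega>. D (Suc t) \<omega> - D t \<omega>) \<omega> = \<mu> t \<omega>"
    and second: "\<And>t. AE \<omega> in M.
      real_cond_exp M (F t) (\<lambda>\<omega>. (D (Suc t) \<omega> - D t \<omega>)\<^sup>2) \<omega> \<le> v t \<omega>"
    and \<kappa>: "\<bar>\<kappa>\<bar> * B \<le> 1"
  shows "AE \<omega> in M. \<exists>K. \<forall>t. - \<kappa> * (D t \<omega> - D 0 \<omega> - (\<Sum>s<t. \<mu> s \<omega>)) - \<kappa>\<^sup>2 * (\<Sum>s<t. v s \<omega>) \<le> K"
proof -
  interpret prob_space M by fact
  \<comment> \<open>The exponent vanishes at time 0, so \<open>Y\<close> starts at 1.\<close>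
  define E where "E t \<omega> = - \<kappa> * (D t \<omega> - D 0 \<omega> - (\<Sum>s<t. \<mu> s \<omega>)) - \<kappa>\<^sup>2 * (\<Sum>s<t. v s \<omega>)" for t \<omega>
  define Y where "Y t \<omega> = exp (E t \<omega>)" for t \<omega>
  define \<Delta> where "\<Delta> t \<omega> = D (Suc t) \<omega> - D t \<omega>" for t \<omega>
  have \<Delta>_eq: "\<Delta> t = (\<lambda>\<omega>. D (Suc t) \<omega> - D t \<omega>)" for t
    by (simp add: \<Delta>_def[abs_def])
  \<comment> \<open>The part of the ratio \<open>Y (Suc t) / Y t\<close> that is already known at
    time \<open>t\<close>; it leaves the conditional expectation as a factor.\<close>
  define e where "e t \<omega> = exp (\<kappa> * \<mu> t \<omega> - \<kappa>\<^sup>2 * v t \<omega>)" for t \<omega>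
  have mono: "f \<in> borel_measurable (F t)" if "f \<in> borel_measurable (F s)" "s \<le> t" for f :: "'w \<Rightarrow> real" and s t
    using that(2,1)
  proof (induction t rule: dec_induct)
    case (step n)
    then show ?case using measurable_from_subalg[OF filt] by blast
  qed
  have FM: "f \<in> borel_measurable M" if "f \<in> borel_measurable (F s)" for f :: "'w \<Rightarrow> real" and s
    using measurable_from_subalg[OF sub that] .
  have [measurable]: "D s \<in> borel_measurable M" "\<mu> s \<in> borel_measurable M" "v s \<in> borel_measurable M" for s
    by (auto intro: FM D \<mu> v)
  have Y_F: "Y t \<in> borel_measurable (F t)" for t
  proof -
    have [measurable]: "D t \<in> borel_measurable (F t)" "D 0 \<in> borel_measurable (F t)"
      by (auto intro: mono[OF D])
    have [measurable]: "(\<lambda>\<omega>. \<Sum>s<t. \<mu> s \<omega>) \<in> borel_measurable (F t)"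
        "(\<lambda>\<omega>. \<Sum>s<t. v s \<omega>) \<in> borel_measurable (F t)"
      by (auto intro!: borel_measurable_sum mono[OF \<mu>] mono[OF v])
    show ?thesis unfolding Y_def E_def by measurable
  qed
  have [measurable]: "Y t \<in> borel_measurable M" for t by (rule FM[OF Y_F])
  have e_F[measurable]: "e t \<in> borel_measurable (F t)" for t
    using \<mu>[of t] v[of t] unfolding e_def by measurable
  have [measurable]: "e t \<in> borel_measurable M" for t by (rule FM[OF e_F])
  have [measurable]: "\<Delta> t \<in> borel_measurable M" for t unfolding \<Delta>_def by measurable
  have Y_Suc: "Y (Suc t) \<omega> = Y t \<omega> * e t \<omega> * exp (- (\<kappa> * \<Delta> t \<omega>))" for t \<omega>
    by (simp add: Y_def E_def e_def \<Delta>_def algebra_simps flip: exp_add)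
  have e_le: "e t \<omega> \<le> exp (\<bar>\<kappa>\<bar> * C)" for t \<omega>
  proof -
    have "\<kappa> * \<mu> t \<omega> \<le> \<bar>\<kappa>\<bar> * C"
      using mult_left_mono[OF \<mu>_bound[of t \<omega>], of "\<bar>\<kappa>\<bar>"] abs_ge_self[of "\<kappa> * \<mu> t \<omega>"]
      by (simp add: abs_mult)
    moreover have "0 \<le> \<kappa>\<^sup>2 * v t \<omega>" using v_nonneg by simp
    ultimately show ?thesis unfolding e_def by simp
  qed
  have \<Delta>_bound: "AE \<omega> in M. \<bar>\<kappa> * \<Delta> t \<omega>\<bar> \<le> 1" for t
    using bound[of t]
  proof eventually_elim
    case (elim \<omega>)
    then have "\<bar>\<kappa>\<bar> * \<bar>\<Delta> t \<omega>\<bar> \<le> \<bar>\<kappa>\<bar> * B" by (auto simp: \<Delta>_def intro: mult_left_mono)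
    with \<kappa> show ?case by (simp add: abs_mult)
  qed
  \<comment> \<open>This bound grows with \<open>t\<close> and serves only for integrability; the
    bound uniform in time comes from the supermartingale property.\<close>
  have Y_bound: "AE \<omega> in M. Y t \<omega> \<le> exp ((\<bar>\<kappa>\<bar> * C + 1) * real t)" for t
  proof (induction t)
    case 0
    then show ?case by (simp add: Y_def E_def)
  next
    case (Suc t)
    show ?case using Suc \<Delta>_bound[of t]
    proof eventually_elim
      case (elim \<omega>)
      have "Y (Suc t) \<omega> \<le> exp ((\<bar>\<kappa>\<bar> * C + 1) * real t) * exp (\<bar>\<kappa>\<bar> * C) * exp 1"
        unfolding Y_Suc using elim by (intro mult_mono e_le) (auto simp: Y_def e_def)
      also have "\<dots> = exp ((\<bar>\<kappa>\<bar> * C + 1) * real (Suc t))"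
        by (simp add: algebra_simps flip: exp_add)
      finally show ?case .
    qed
  qed
  have Y_int: "integrable M (Y t)" for t
    by (rule integrable_const_bound[where B = "exp ((\<bar>\<kappa>\<bar> * C + 1) * real t)"])
      (use Y_bound[of t] in \<open>auto simp: Y_def\<close>)
  have super: "AE \<omega> in M. real_cond_exp M (F t) (Y (Suc t)) \<omega> \<le> Y t \<omega>" for t
  proof -
    interpret S: finite_measure_subalgebra M "F t"
      by unfold_locales (rule sub)
    define q where "q \<omega> = 1 - \<kappa> * \<Delta> t \<omega> + \<kappa>\<^sup>2 * (\<Delta> t \<omega>)\<^sup>2" for \<omega>
    have [measurable]: "q \<in> borel_measurable M" unfolding q_def by measurable
    have \<Delta>_int: "integrable M (\<Delta> t)"
      by (rule integrable_const_bound[where B = B]) (use bound[of t] in \<open>auto simp: \<Delta>_def\<close>)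
    have \<Delta>2_int: "integrable M (\<lambda>\<omega>. (\<Delta> t \<omega>)\<^sup>2)"
      by (rule integrable_const_bound[where B = "B\<^sup>2"])
        (use bound[of t] in \<open>auto simp: \<Delta>_def abs_le_square_iff[symmetric] intro: order_trans[OF _ abs_ge_self]\<close>)
    have q_le: "AE \<omega> in M. Y (Suc t) \<omega> \<le> (Y t \<omega> * e t \<omega>) * q \<omega>"
      using \<Delta>_bound[of t]
    proof eventually_elim
      case (elim \<omega>)
      show ?case unfolding Y_Suc q_def
        using exp_minus_le_quadratic[OF elim]
        by (intro mult_left_mono) (auto simp: power_mult_distrib Y_def e_def)
    qed
    have q_int: "integrable M (\<lambda>\<omega>. (Y t \<omega> * e t \<omega>) * q \<omega>)"
    proof (rule integrable_const_bound[where B = "exp ((\<bar>\<kappa>\<bar> * C + 1) * real t) * exp (\<bar>\<kappa>\<bar> * C) * 3"])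
      show "AE \<omega> in M. norm ((Y t \<omega> * e t \<omega>) * q \<omega>)
          \<le> exp ((\<bar>\<kappa>\<bar> * C + 1) * real t) * exp (\<bar>\<kappa>\<bar> * C) * 3"
        using \<Delta>_bound[of t] Y_bound[of t]
      proof eventually_elim
        case (elim \<omega>)
        have "(\<kappa> * \<Delta> t \<omega>)\<^sup>2 \<le> 1" using elim(1) by (simp add: abs_square_le_1)
        then have "\<bar>q \<omega>\<bar> \<le> 3" using elim(1) by (auto simp: q_def power_mult_distrib abs_le_iff)
        then have "\<bar>Y t \<omega>\<bar> * \<bar>e t \<omega>\<bar> * \<bar>q \<omega>\<bar> \<le> exp ((\<bar>\<kappa>\<bar> * C + 1) * real t) * exp (\<bar>\<kappa>\<bar> * C) * 3"
          using elim(2) e_le[of t \<omega>] by (intro mult_mono) (auto simp: Y_def e_def)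
        then show ?case by (simp add: abs_mult)
      qed
    qed measurable
    have 1: "AE \<omega> in M. real_cond_exp M (F t) (Y (Suc t)) \<omega>
        \<le> real_cond_exp M (F t) (\<lambda>\<omega>. (Y t \<omega> * e t \<omega>) * q \<omega>) \<omega>"
      by (rule S.real_cond_exp_mono[OF q_le Y_int q_int])
    have 2: "AE \<omega> in M. real_cond_exp M (F t) (\<lambda>\<omega>. (Y t \<omega> * e t \<omega>) * q \<omega>) \<omega>
        = (Y t \<omega> * e t \<omega>) * real_cond_exp M (F t) q \<omega>"
      by (rule S.real_cond_exp_mult) (use Y_F q_int in auto)
    have 3: "AE \<omega> in M. real_cond_exp M (F t) q \<omega>
        = real_cond_exp M (F t) (\<lambda>\<omega>. 1 - \<kappa> * \<Delta> t \<omega>) \<omega>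
          + real_cond_exp M (F t) (\<lambda>\<omega>. \<kappa>\<^sup>2 * (\<Delta> t \<omega>)\<^sup>2) \<omega>"
      unfolding q_def using \<Delta>_int \<Delta>2_int by (intro S.real_cond_exp_add) auto
    have 4: "AE \<omega> in M. real_cond_exp M (F t) (\<lambda>\<omega>. 1 - \<kappa> * \<Delta> t \<omega>) \<omega>
        = real_cond_exp M (F t) (\<lambda>\<omega>. 1) \<omega> - real_cond_exp M (F t) (\<lambda>\<omega>. \<kappa> * \<Delta> t \<omega>) \<omega>"
      using \<Delta>_int by (intro S.real_cond_exp_diff) auto
    have 5: "AE \<omega> in M. real_cond_exp M (F t) (\<lambda>\<omega>. \<kappa> * \<Delta> t \<omega>) \<omega> = \<kappa> * real_cond_exp M (F t) (\<Delta> t) \<omega>"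
      by (rule S.real_cond_exp_cmult[OF \<Delta>_int])
    have 6: "AE \<omega> in M. real_cond_exp M (F t) (\<lambda>\<omega>. \<kappa>\<^sup>2 * (\<Delta> t \<omega>)\<^sup>2) \<omega>
        = \<kappa>\<^sup>2 * real_cond_exp M (F t) (\<lambda>\<omega>. (\<Delta> t \<omega>)\<^sup>2) \<omega>"
      by (rule S.real_cond_exp_cmult[OF \<Delta>2_int])
    have 7: "AE \<omega> in M. real_cond_exp M (F t) (\<lambda>\<omega>. 1) \<omega> = 1"
      by (rule S.real_cond_exp_F_meas) auto
    show ?thesis
      using 1 2 3 4 5 6 7 first[of t, folded \<Delta>_eq] second[of t, folded \<Delta>_def]
    proof eventually_elim
      case (elim \<omega>)
      have "real_cond_exp M (F t) q \<omega> = 1 - \<kappa> * \<mu> t \<omega>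
          + \<kappa>\<^sup>2 * real_cond_exp M (F t) (\<lambda>\<omega>. (\<Delta> t \<omega>)\<^sup>2) \<omega>"
        using elim(3-8) by simp
      also have "\<dots> \<le> 1 - \<kappa> * \<mu> t \<omega> + \<kappa>\<^sup>2 * v t \<omega>"
        using elim(9) by (simp add: mult_left_mono)
      \<comment> \<open>Since 1 + x is at most exp x, the conditional mean of \<open>q\<close> is at
        most the inverse of \<open>e t\<close>, which is exactly what the compensator
        cancels.\<close>
      also have "\<dots> \<le> exp (- \<kappa> * \<mu> t \<omega> + \<kappa>\<^sup>2 * v t \<omega>)"
        using exp_ge_add_one_self[of "- \<kappa> * \<mu> t \<omega> + \<kappa>\<^sup>2 * v t \<omega>"] by (simp add: algebra_simps)
      finally have "(Y t \<omega> * e t \<omega>) * real_cond_exp M (F t) q \<omega>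
          \<le> (Y t \<omega> * e t \<omega>) * exp (- \<kappa> * \<mu> t \<omega> + \<kappa>\<^sup>2 * v t \<omega>)"
        by (intro mult_left_mono) (auto simp: Y_def e_def)
      also have "\<dots> = Y t \<omega>"
        by (simp add: e_def mult.assoc flip: exp_add)
      finally show ?case using elim(1,2) by simp
    qed
  qed
  have "AE \<omega> in M. \<exists>K. \<forall>t. Y t \<omega> \<le> K"
    by (rule nonneg_supermartingale_AE_bounded[where F = F and Y = Y])
      (use \<open>prob_space M\<close> sub filt Y_F Y_int super in \<open>auto simp: Y_def\<close>)
  then show ?thesis
  proof eventually_elim
    case (elim \<omega>)
    then obtain K where K: "\<And>t. Y t \<omega> \<le> K" by blast
    \<comment> \<open>As x + 1 is at most exp x, a bound on \<open>Y\<close> bounds its exponent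
      without taking logarithms.\<close>
    have "E t \<omega> \<le> K" for t :: nat
      using K[of t] exp_ge_add_one_self[of "E t \<omega>"] unfolding Y_def by linarith
    then show ?case unfolding E_def by blast
  qed
qed

text \<open>Using the previous bound with \<kappa> and -\<kappa> and dividing by \<kappa> leaves the
  variance with the small coefficient \<kappa>, at the price of a large random constant. Only
  countably many values of \<kappa> are used, so one null set serves all \<epsilon>.\<close>

lemma AE_drift_two_sided_bound:
  fixes D \<mu> v :: "nat \<Rightarrow> 'w \<Rightarrow> real"
  assumes "prob_space M"
    and "\<And>t. subalgebra M (F t)"
    and "\<And>t. subalgebra (F (Suc t)) (F t)"
    and "\<And>t. D t \<in> borel_measurable (F t)"
    and "\<And>t. \<mu> t \<in> borel_measurable (F t)"
    and "\<And>t. v t \<in> borel_measurable (F t)"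
    and "\<And>t. AE \<omega> in M. \<bar>D (Suc t) \<omega> - D t \<omega>\<bar> \<le> B"
    and "\<And>t \<omega>. \<bar>\<mu> t \<omega>\<bar> \<le> C"
    and "\<And>t \<omega>. 0 \<le> v t \<omega>"
    and "\<And>t. AE \<omega> in M. real_cond_exp M (F t) (\<lambda>\<omega>. D (Suc t) \<omega> - D t \<omega>) \<omega> = \<mu> t \<omega>"
    and "\<And>t. AE \<omega> in M.
      real_cond_exp M (F t) (\<lambda>\<omega>. (D (Suc t) \<omega> - D t \<omega>)\<^sup>2) \<omega> \<le> v t \<omega>"
  shows "AE \<omega> in M. \<forall>\<epsilon>>0. \<exists>K. \<forall>t.
    \<bar>D t \<omega> - D 0 \<omega> - (\<Sum>s<t. \<mu> s \<omega>)\<bar> \<le> \<epsilon> * (\<Sum>s<t. v s \<omega>) + K"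
proof -
  define B' where "B' = max 1 B"
  have B': "B' \<ge> 1" "B \<le> B'" by (auto simp: B'_def)
  \<comment> \<open>The scales tend to 0 and respect the constraint \<open>l n * B \<le> 1\<close>;
    taking \<open>B'\<close> at least 1 also gives
    \<open>l n \<le> 1 / real (Suc n)\<close>.\<close>
  define l where "l n = 1 / (B' * real (Suc n))" for n
  have l: "l n > 0" "l n * B \<le> 1" for n
  proof -
    show "l n > 0" using B' by (simp add: l_def)
    then have "l n * B \<le> l n * B'" using B' by (intro mult_left_mono) auto
    also have "l n * B' = 1 / real (Suc n)" using B' by (simp only: l_def) simp
    also have "\<dots> \<le> 1" by simp
    finally show "l n * B \<le> 1" .
  qed
  define Q where "Q \<kappa> \<omega> \<longleftrightarrow> (\<exists>K. \<forall>t.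
      - \<kappa> * (D t \<omega> - D 0 \<omega> - (\<Sum>s<t. \<mu> s \<omega>)) - \<kappa>\<^sup>2 * (\<Sum>s<t. v s \<omega>) \<le> K)" for \<kappa> \<omega>
  have lower: "AE \<omega> in M. Q \<kappa> \<omega>" if "\<bar>\<kappa>\<bar> * B \<le> 1" for \<kappa>
    unfolding Q_def
    by (rule AE_drift_lower_bound[where F = F and D = D and \<mu> = \<mu> and v = v and B = B and C = C])
      (use assms that in simp_all)
  have "AE \<omega> in M. Q (l n) \<omega> \<and> Q (- l n) \<omega>" for n
    using l[of n] by (intro AE_conjI lower) auto
  then have "AE \<omega> in M. \<forall>n. Q (l n) \<omega> \<and> Q (- l n) \<omega>"
    unfolding AE_all_countable by blast
  then show ?thesis
  proof eventually_elim
    case (elim \<omega>)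
    show ?case
    proof (intro allI impI)
      fix \<epsilon> :: real assume "\<epsilon> > 0"
      then obtain n where n: "inverse (real (Suc n)) < \<epsilon>" using reals_Archimedean by blast
      have "real (Suc n) \<le> B' * real (Suc n)"
        using mult_right_mono[OF B'(1), of "real (Suc n)"] by simp
      then have "l n \<le> 1 / real (Suc n)" unfolding l_def by (intro frac_le) auto
      then have ln: "l n \<le> \<epsilon>" using n by (simp add: inverse_eq_divide)
      let ?M = "\<lambda>t. D t \<omega> - D 0 \<omega> - (\<Sum>s<t. \<mu> s \<omega>)" and ?V = "\<lambda>t. \<Sum>s<t. v s \<omega>"
      have Q: "Q (l n) \<omega>" "Q (- l n) \<omega>" using elim by blast+
      obtain K1 where K1: "\<And>t. - l n * ?M t - (l n)\<^sup>2 * ?V t \<le> K1"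
        using Q(1) unfolding Q_def by blast
      obtain K2 where "\<And>t. - (- l n) * ?M t - (- l n)\<^sup>2 * ?V t \<le> K2"
        using Q(2) unfolding Q_def by blast
      then have K2: "l n * ?M t - (l n)\<^sup>2 * ?V t \<le> K2" for t
        by (simp only: minus_minus power2_minus)
      have "\<bar>?M t\<bar> \<le> \<epsilon> * ?V t + max K1 K2 / l n" for t
      proof -
        have "\<bar>l n * ?M t\<bar> \<le> (l n)\<^sup>2 * ?V t + max K1 K2"
          using K1[of t] K2[of t] unfolding mult_minus_left by linarith
        then have "l n * \<bar>?M t\<bar> \<le> (l n)\<^sup>2 * ?V t + max K1 K2"
          using l(1)[of n] by (simp add: abs_mult)
        then have "\<bar>?M t\<bar> \<le> l n * ?V t + max K1 K2 / l n"
          using l(1)[of n] by (simp add: field_simps power2_eq_square)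
        moreover have "l n * ?V t \<le> \<epsilon> * ?V t"
          using ln assms(9) by (intro mult_right_mono sum_nonneg) auto
        ultimately show ?thesis by linarith
      qed
      then show "\<exists>K. \<forall>t. \<bar>?M t\<bar> \<le> \<epsilon> * ?V t + K" by blast
    qed
  qed
qed

section \<open>Drift and variance along a sequence of policies\<close>

text \<open>Both sides are the covariance of \<open>r\<close> and \<open>y\<close> under the weights
  \<open>p\<close>, the right one written with two independent copies. The differences of pairs are
  what the feature condition controls.\<close>

lemma weighted_covariance_eq:
  fixes p r y :: "'k::finite \<Rightarrow> real"
  assumes "(\<Sum>a\<in>UNIV. p a) = 1"
  shows "(\<Sum>a\<in>UNIV. p a * r a * (y a - (\<Sum>b\<in>UNIV. p b * y b)))
    = (\<Sum>i\<in>UNIV. \<Sum>j\<in>UNIV. p i * p j * ((r i - r j) * (y i - y j))) / 2"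
proof -
  let ?S = "\<lambda>f. \<Sum>a\<in>UNIV. p a * f a"
  have "(\<Sum>i\<in>UNIV. \<Sum>j\<in>UNIV. p i * p j * ((r i - r j) * (y i - y j)))
      = (\<Sum>i\<in>UNIV. \<Sum>j\<in>UNIV. (p i * (r i * y i)) * p j + p i * (p j * (r j * y j))
          - (p i * r i) * (p j * y j) - (p i * y i) * (p j * r j))"
    by (intro sum.cong refl) (simp add: algebra_simps)
  also have "\<dots> = 2 * (?S (\<lambda>a. r a * y a) - ?S r * ?S y)"
    by (simp add: sum.distrib sum_subtractf assms flip: sum_distrib_left sum_distrib_right)
  also have "?S (\<lambda>a. r a * y a) - ?S r * ?S y
      = (\<Sum>a\<in>UNIV. p a * r a * (y a - (\<Sum>b\<in>UNIV. p b * y b)))"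
    by (simp only: right_diff_distrib sum_subtractf sum_distrib_right[symmetric] mult.assoc[symmetric])
  finally show ?thesis by simp
qed

text \<open>This is the covariance formula with \<open>r = y\<close>: the constant \<open>m\<close>
  may be subtracted from the first factor because the centred weights sum to 0.\<close>

lemma weighted_variance_eq:
  fixes p y :: "'k::finite \<Rightarrow> real"
  assumes p: "(\<Sum>a\<in>UNIV. p a) = 1"
  shows "(\<Sum>a\<in>UNIV. p a * (y a - (\<Sum>b\<in>UNIV. p b * y b))\<^sup>2)
    = (\<Sum>i\<in>UNIV. \<Sum>j\<in>UNIV. p i * p j * (y i - y j)\<^sup>2) / 2"
proof -
  define m where "m = (\<Sum>b\<in>UNIV. p b * y b)"
  have "(\<Sum>a\<in>UNIV. p a * (y a - m)\<^sup>2)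
      = (\<Sum>a\<in>UNIV. p a * y a * (y a - m)) - m * (\<Sum>a\<in>UNIV. p a * (y a - m))"
    by (simp add: sum_distrib_left power2_eq_square algebra_simps flip: sum_subtractf)
  also have "(\<Sum>a\<in>UNIV. p a * (y a - m)) = 0"
    using p by (simp add: right_diff_distrib sum_subtractf m_def flip: sum_distrib_right)
  finally show ?thesis
    using weighted_covariance_eq[OF p, of y y] by (simp add: m_def power2_eq_square)
qed

text \<open>Source of the constants below, which depend on rewards and features but not on the
  policy.\<close>

lemma finite_type_upper_bound:
  fixes f :: "'a::finite \<Rightarrow> real"
  obtains C where "C > 0" "\<And>x. f x \<le> C"
proof
  show "1 + (\<Sum>x\<in>UNIV. \<bar>f x\<bar>) > 0" by (intro add_pos_nonneg sum_nonneg) auto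
  show "f x \<le> 1 + (\<Sum>x\<in>UNIV. \<bar>f x\<bar>)" for x
    using member_le_sum[of x UNIV "\<lambda>x. \<bar>f x\<bar>"] abs_ge_self[of "f x"] by simp
qed

text \<open>The pairs with both indices at least \<open>k\<close> are the only ones whose covariance term may be
  negative; they are responsible for the error term in the first bound.\<close>

lemma covariance_dominates_variance:
  fixes r y :: "'k::{finite,linorder} \<Rightarrow> real"
  assumes r: "\<And>a b. a < b \<Longrightarrow> r a > r b"
    and best: "\<And>a. best \<le> a" and k: "best \<noteq> k"
    and ge: "\<And>i j. i < j \<Longrightarrow> i < k \<Longrightarrow> y i \<ge> y j"
    and gt: "\<And>j. j \<noteq> best \<Longrightarrow> y best > y j"
  obtains \<alpha> \<gamma> C where "\<alpha> > 0" "\<gamma> > 0" "C > 0"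
    and "\<And>p. (\<And>a. p a \<ge> 0) \<Longrightarrow> (\<Sum>a\<in>UNIV. p a) = 1 \<Longrightarrow>
      \<alpha> * (\<Sum>i\<in>UNIV. \<Sum>j\<in>UNIV. p i * p j * (y i - y j)\<^sup>2) - \<gamma> * ((1 - p best) * (\<Sum>j | k < j. p j))
        \<le> (\<Sum>i\<in>UNIV. \<Sum>j\<in>UNIV. p i * p j * ((r i - r j) * (y i - y j)))"
    and "\<And>p. (\<And>a. p a \<ge> 0) \<Longrightarrow> (\<Sum>a\<in>UNIV. p a) = 1 \<Longrightarrow>
      \<bar>\<Sum>i\<in>UNIV. \<Sum>j\<in>UNIV. p i * p j * ((r i - r j) * (y i - y j))\<bar>
        \<le> C * (\<Sum>i\<in>UNIV. \<Sum>j\<in>UNIV. p i * p j * (y i - y j)\<^sup>2)"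
    and "\<And>p. (\<And>a. p a \<ge> 0) \<Longrightarrow> (\<Sum>a\<in>UNIV. p a) = 1 \<Longrightarrow>
      p best * (1 - p best) \<le> C * (\<Sum>i\<in>UNIV. \<Sum>j\<in>UNIV. p i * p j * (y i - y j)\<^sup>2)"
proof -
  define g where "g i j = y i - y j" for i j
  define h where "h i j = (r i - r j) * g i j" for i j
  \<comment> \<open>\<open>A\<close> compares feature differences with reward gaps,
    \<open>C1\<close> makes the converse comparison, and \<open>C2\<close> bounds the inverse
    squared differences against the best action. Quotients by 0 count as 0; the cases that need more
    are treated separately. \<gamma> is the largest deficit any pair can have.\<close>
  obtain A where A: "A > 0" "\<And>ij. (\<lambda>(i, j). \<bar>g i j\<bar> / \<bar>r i - r j\<bar>) ij \<le> A"
    using finite_type_upper_bound[of "(\<lambda>(i, j). \<bar>g i j\<bar> / \<bar>r i - r j\<bar>)"] by blast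
  obtain C1 where C1: "C1 > 0" "\<And>ij. (\<lambda>(i, j). \<bar>r i - r j\<bar> / \<bar>g i j\<bar>) ij \<le> C1"
    using finite_type_upper_bound[of "(\<lambda>(i, j). \<bar>r i - r j\<bar> / \<bar>g i j\<bar>)"] by blast
  obtain C2 where C2: "C2 > 0" "\<And>j. 1 / (g best j)\<^sup>2 \<le> C2"
    using finite_type_upper_bound[of "\<lambda>j. 1 / (g best j)\<^sup>2"] by blast
  obtain \<gamma> where \<gamma>: "\<gamma> > 0" "\<And>ij. (\<lambda>(i, j). (g i j)\<^sup>2 / A - h i j) ij \<le> \<gamma>"
    using finite_type_upper_bound[of "(\<lambda>(i, j). (g i j)\<^sup>2 / A - h i j)"] by blast
  have r_ne: "r i \<noteq> r j" if "i \<noteq> j" for i j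
    using that r[of i j] r[of j i] by (cases i j rule: linorder_cases) auto
  have gA: "\<bar>g i j\<bar> \<le> A * \<bar>r i - r j\<bar>" for i j
  proof (cases "i = j")
    case False
    then show ?thesis using A(2)[of "(i, j)"] r_ne[OF False] by (simp add: field_simps)
  qed (simp add: g_def)
  have h_abs: "\<bar>h i j\<bar> \<le> C1 * (g i j)\<^sup>2" for i j
  proof (cases "g i j = 0")
    case False
    then have "\<bar>r i - r j\<bar> \<le> C1 * \<bar>g i j\<bar>" using C1(2)[of "(i, j)"] by (simp add: field_simps)
    then have "\<bar>r i - r j\<bar> * \<bar>g i j\<bar> \<le> C1 * \<bar>g i j\<bar> * \<bar>g i j\<bar>" by (intro mult_right_mono) auto
    then show ?thesis by (simp add: h_def abs_mult power2_eq_square)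
  qed (simp add: h_def)
  \<comment> \<open>If one index is below \<open>k\<close>, then so is the smaller one, hence
    \<open>ge\<close> applies and the two factors of \<open>h i j\<close> have the same
    sign.\<close>
  have h_good: "(g i j)\<^sup>2 / A \<le> h i j" if "i < k \<or> j < k" for i j
  proof -
    have "h i j = \<bar>r i - r j\<bar> * \<bar>g i j\<bar>"
    proof (cases i j rule: linorder_cases)
      case less
      then have "y i \<ge> y j" using that ge by auto
      then show ?thesis using r[OF less] by (simp add: h_def g_def)
    next
      case greater
      then have "y j \<ge> y i" using that ge by auto
      then show ?thesis using r[OF greater] by (simp add: h_def g_def algebra_simps)
    qed (simp add: h_def)
    moreover have "\<bar>g i j\<bar> * \<bar>g i j\<bar> \<le> (A * \<bar>r i - r j\<bar>) * \<bar>g i j\<bar>"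
      by (intro mult_right_mono gA) auto
    ultimately show ?thesis using A(1) by (simp add: field_simps power2_eq_square)
  qed
  \<comment> \<open>In a bad pair of distinct indices neither is \<open>best\<close> and at least
    one exceeds \<open>k\<close>. The two conditions are charged to different indices, so that the
    double sum of the error factorizes.\<close>
  have h_lower: "(g i j)\<^sup>2 / A - \<gamma> * (of_bool (i \<noteq> best \<and> k < j) + of_bool (k < i \<and> j \<noteq> best)) \<le> h i j" for i j
  proof (cases "i < k \<or> j < k")
    case True
    then show ?thesis using h_good[OF True] \<gamma>(1) by (auto simp: of_bool_def split: if_splits)
  next
    case False
    then have "i \<noteq> best" "j \<noteq> best" using best[of k] k by auto
    show ?thesis
    proof (cases "i = j")
      case True
      then show ?thesis using \<gamma>(1) by (auto simp: h_def g_def)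
    next
      case ij: False
      then have "k < i \<or> k < j" using False by auto
      moreover have "(g i j)\<^sup>2 / A - h i j \<le> \<gamma>" using \<gamma>(2)[of "(i, j)"] by simp
      ultimately show ?thesis using \<open>i \<noteq> best\<close> \<open>j \<noteq> best\<close> \<gamma>(1) by auto
    qed
  qed
  show thesis
  proof (rule that)
    \<comment> \<open>The factor 2 of \<gamma> counts the two symmetric indicators of
      \<open>h_lower\<close>.\<close>
    show "1 / A > 0" "2 * \<gamma> > 0" "max C1 C2 > 0" using A(1) \<gamma>(1) C1(1) by auto
  next
    fix p :: "'k \<Rightarrow> real" assume p: "\<And>a. p a \<ge> 0" and sum_p: "(\<Sum>a\<in>UNIV. p a) = 1"
    have not_o: "(\<Sum>i | i \<noteq> best. p i) = 1 - p best"
      using sum_p sum.remove[of UNIV best p] by (simp add: Collect_neg_eq[symmetric] Compl_eq_Diff_UNIV[symmetric] set_diff_eq)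
    have B1: "(\<Sum>i\<in>UNIV. \<Sum>j\<in>UNIV. p i * p j * of_bool (i \<noteq> best \<and> k < j)) = (1 - p best) * (\<Sum>j | k < j. p j)"
    proof -
      have "(\<Sum>i\<in>UNIV. \<Sum>j\<in>UNIV. p i * p j * of_bool (i \<noteq> best \<and> k < j))
          = (\<Sum>i\<in>UNIV. \<Sum>j\<in>UNIV. (p i * of_bool (i \<noteq> best)) * (p j * of_bool (k < j)))"
        by (intro sum.cong refl) auto
      also have "\<dots> = (\<Sum>i\<in>UNIV. p i * of_bool (i \<noteq> best)) * (\<Sum>j\<in>UNIV. p j * of_bool (k < j))"
        by (rule sum_product[symmetric])
      also have "(\<Sum>i\<in>UNIV. p i * of_bool (i \<noteq> best)) = 1 - p best"
        unfolding not_o[symmetric] by (rule sum.mono_neutral_cong_right) auto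
      also have "(\<Sum>j\<in>UNIV. p j * of_bool (k < j)) = (\<Sum>j | k < j. p j)"
        by (rule sum.mono_neutral_cong_right) auto
      finally show ?thesis .
    qed
    have B2: "(\<Sum>i\<in>UNIV. \<Sum>j\<in>UNIV. p i * p j * of_bool (k < i \<and> j \<noteq> best)) = (1 - p best) * (\<Sum>j | k < j. p j)"
      unfolding B1[symmetric] by (subst sum.swap) (simp add: mult.commute conj_commute)
    have "(\<Sum>i\<in>UNIV. \<Sum>j\<in>UNIV. p i * p j * ((g i j)\<^sup>2 / A - \<gamma> * (of_bool (i \<noteq> best \<and> k < j) + of_bool (k < i \<and> j \<noteq> best))))
        \<le> (\<Sum>i\<in>UNIV. \<Sum>j\<in>UNIV. p i * p j * h i j)"
      by (intro sum_mono mult_left_mono h_lower) (simp add: p)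
    also have "(\<Sum>i\<in>UNIV. \<Sum>j\<in>UNIV. p i * p j * ((g i j)\<^sup>2 / A - \<gamma> * (of_bool (i \<noteq> best \<and> k < j) + of_bool (k < i \<and> j \<noteq> best))))
        = (\<Sum>i\<in>UNIV. \<Sum>j\<in>UNIV. (1 / A) * (p i * p j * (g i j)\<^sup>2)
            - \<gamma> * (p i * p j * of_bool (i \<noteq> best \<and> k < j)) - \<gamma> * (p i * p j * of_bool (k < i \<and> j \<noteq> best)))"
      by (intro sum.cong refl) (simp only: algebra_simps divide_inverse mult_1_left)
    also have "\<dots> = (1 / A) * (\<Sum>i\<in>UNIV. \<Sum>j\<in>UNIV. p i * p j * (g i j)\<^sup>2)
        - 2 * \<gamma> * ((1 - p best) * (\<Sum>j | k < j. p j))"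
      by (simp only: sum_subtractf sum_distrib_left[symmetric] B1 B2)
    finally show "1 / A * (\<Sum>i\<in>UNIV. \<Sum>j\<in>UNIV. p i * p j * (y i - y j)\<^sup>2) - 2 * \<gamma> * ((1 - p best) * (\<Sum>j | k < j. p j))
        \<le> (\<Sum>i\<in>UNIV. \<Sum>j\<in>UNIV. p i * p j * ((r i - r j) * (y i - y j)))"
      by (simp only: g_def h_def)
    have S: "C' * (\<Sum>i\<in>UNIV. \<Sum>j\<in>UNIV. p i * p j * (g i j)\<^sup>2)
        \<le> max C1 C2 * (\<Sum>i\<in>UNIV. \<Sum>j\<in>UNIV. p i * p j * (g i j)\<^sup>2)" if "C' = C1 \<or> C' = C2" for C'
      using that by (intro mult_right_mono sum_nonneg) (auto simp: p)
    have "\<bar>\<Sum>i\<in>UNIV. \<Sum>j\<in>UNIV. p i * p j * h i j\<bar> \<le> (\<Sum>i\<in>UNIV. \<Sum>j\<in>UNIV. \<bar>p i * p j * h i j\<bar>)"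
      by (rule order_trans[OF sum_abs], rule sum_mono, rule sum_abs)
    also have "\<dots> \<le> (\<Sum>i\<in>UNIV. \<Sum>j\<in>UNIV. p i * p j * (C1 * (g i j)\<^sup>2))"
      unfolding abs_mult using p by (intro sum_mono mult_mono h_abs) auto
    also have "\<dots> = C1 * (\<Sum>i\<in>UNIV. \<Sum>j\<in>UNIV. p i * p j * (g i j)\<^sup>2)"
      by (simp add: sum_distrib_left algebra_simps)
    finally show "\<bar>\<Sum>i\<in>UNIV. \<Sum>j\<in>UNIV. p i * p j * ((r i - r j) * (y i - y j))\<bar>
        \<le> max C1 C2 * (\<Sum>i\<in>UNIV. \<Sum>j\<in>UNIV. p i * p j * (y i - y j)\<^sup>2)"
      using S[of C1] by (simp add: g_def h_def)
    have C2': "1 \<le> C2 * (g best j)\<^sup>2" if "j \<noteq> best" for j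
      using C2(2)[of j] gt[OF that] by (simp add: g_def field_simps)
    \<comment> \<open>Of all pairs only those with first index \<open>best\<close> are kept; there
      the feature differences are nonzero.\<close>
    have "p best * (1 - p best) = (\<Sum>j | j \<noteq> best. p best * p j)"
      by (simp add: not_o flip: sum_distrib_left)
    also have "\<dots> \<le> (\<Sum>j | j \<noteq> best. p best * p j * (C2 * (g best j)\<^sup>2))"
    proof (rule sum_mono)
      fix j assume "j \<in> {j. j \<noteq> best}"
      then have "p best * p j * 1 \<le> p best * p j * (C2 * (g best j)\<^sup>2)"
        using p by (intro mult_left_mono C2') auto
      then show "p best * p j \<le> p best * p j * (C2 * (g best j)\<^sup>2)" by simp
    qed
    also have "\<dots> \<le> (\<Sum>j\<in>UNIV. p best * p j * (C2 * (g best j)\<^sup>2))"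
      using p C2(1) by (intro sum_mono2) auto
    also have "\<dots> \<le> (\<Sum>i\<in>UNIV. \<Sum>j\<in>UNIV. p i * p j * (C2 * (g i j)\<^sup>2))"
      using p C2(1) by (intro member_le_sum[of best UNIV "\<lambda>i. \<Sum>j\<in>UNIV. p i * p j * (C2 * (g i j)\<^sup>2)"] sum_nonneg) auto
    also have "\<dots> = C2 * (\<Sum>i\<in>UNIV. \<Sum>j\<in>UNIV. p i * p j * (g i j)\<^sup>2)"
      by (simp add: sum_distrib_left algebra_simps)
    finally show "p best * (1 - p best) \<le> max C1 C2 * (\<Sum>i\<in>UNIV. \<Sum>j\<in>UNIV. p i * p j * (y i - y j)\<^sup>2)"
      using S[of C2] by (simp add: g_def)
  qed
qed

section \<open>The dichotomy along a single trajectory\<close>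

text \<open>A deterministic induction step from the actions worse than \<open>k\<close> to
  \<open>k\<close>; randomness enters only through \<open>conc\<close>. The worse actions with
  summable probabilities cost a finite total error. For the others, the ratio to \<open>best\<close>
  is eventually so small that half of the variance term pays for them.\<close>

lemma summable_or_ratio_tendsto_0:
  fixes p :: "nat \<Rightarrow> 'k::{finite,linorder} \<Rightarrow> real" and \<mu> v D :: "nat \<Rightarrow> real"
  assumes p: "\<And>t a. p t a > 0" and sum_p: "\<And>t. (\<Sum>a\<in>UNIV. p t a) = 1"
    and k: "best \<noteq> k"
    and D: "\<And>t. p t k = p t best * exp (- D t)"
    and pos: "\<alpha> > 0" "\<gamma> > 0" "C > 0"
    and lower: "\<And>t. \<alpha> * v t - \<gamma> * ((1 - p t best) * (\<Sum>j | k < j. p t j)) \<le> \<mu> t"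
    and \<mu>_abs: "\<And>t. \<bar>\<mu> t\<bar> \<le> C * v t"
    and v_lower: "\<And>t. p t best * (1 - p t best) \<le> C * v t"
    and conc: "\<And>\<epsilon>. \<epsilon> > 0 \<Longrightarrow> \<exists>K. \<forall>t. \<bar>D t - D 0 - (\<Sum>s<t. \<mu> s)\<bar> \<le> \<epsilon> * (\<Sum>s<t. v s) + K"
    and worse: "\<And>j. k < j \<Longrightarrow> summable (\<lambda>t. p t j) \<or> (\<lambda>t. p t j / p t best) \<longlonglongrightarrow> 0"
  shows "summable (\<lambda>t. p t k) \<or> (\<lambda>t. p t k / p t best) \<longlonglongrightarrow> 0"
proof -
  have p_le: "p t i + p t j \<le> 1" if "i \<noteq> j" for t i j
    using sum_mono2[of UNIV "{i, j}" "p t"] that p[of t] by (simp add: sum_p less_imp_le)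
  have p1: "p t a < 1" if "a = best" for t a
    using p_le[OF k, of t] p[of t k] that by simp
  have v0: "v t \<ge> 0" for t
    using order_trans[OF abs_ge_zero \<mu>_abs[of t]] pos(3) by (simp add: zero_le_mult_iff)
  define J where "J = {j. k < j \<and> summable (\<lambda>t. p t j)}"
  define J' where "J' = {j. k < j \<and> \<not> summable (\<lambda>t. p t j)}"
  define s where "s t = \<gamma> * (\<Sum>j\<in>J. p t j)" for t
  have s: "summable s" "s t \<ge> 0" for t
    unfolding s_def using p pos(2)
    by (auto intro!: summable_mult summable_sum mult_nonneg_nonneg sum_nonneg simp: J_def less_imp_le)
  \<comment> \<open>With this choice the actions in \<open>J'\<close> cost at most
    \<open>\<alpha> / 2 * v t\<close> after multiplication by \<gamma>; the successor avoids
    division by 0 when \<open>J'\<close> is empty.\<close>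
  define \<delta> where "\<delta> = \<alpha> / (2 * \<gamma> * C * real (Suc (card J')))"
  have \<delta>: "\<delta> > 0" unfolding \<delta>_def using pos by (intro divide_pos_pos mult_pos_pos) auto
  have "\<forall>\<^sub>F t in sequentially. \<forall>j\<in>J'. p t j / p t best < \<delta>"
    using worse \<delta> by (intro eventually_ball_finite) (auto simp: J'_def dest: order_tendstoD(2))
  then have ev: "\<forall>\<^sub>F t in sequentially. \<alpha> / 2 * v t - s t \<le> \<mu> t"
  proof eventually_elim
    case (elim t)
    have split: "(\<Sum>j | k < j. p t j) = (\<Sum>j\<in>J. p t j) + (\<Sum>j\<in>J'. p t j)"
      by (subst sum.union_disjoint[symmetric]) (auto simp: J_def J'_def intro: sum.cong)
    have "(1 - p t best) * (\<Sum>j\<in>J'. p t j) \<le> (1 - p t best) * (real (card J') * (\<delta> * p t best))"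
      using elim p[of t] p1[of best t]
      by (intro mult_left_mono sum_bounded_above) (auto simp: field_simps less_imp_le)
    moreover have "(1 - p t best) * (\<Sum>j\<in>J. p t j) \<le> 1 * (\<Sum>j\<in>J. p t j)"
      using p[of t] by (intro mult_right_mono sum_nonneg) (auto simp: less_imp_le)
    moreover have "(1 - p t best) * (real (card J') * (\<delta> * p t best)) \<le> \<alpha> / (2 * \<gamma>) * v t"
    proof -
      have "(1 - p t best) * (real (card J') * (\<delta> * p t best)) = (real (card J') * \<delta>) * (p t best * (1 - p t best))"
        by simp
      also have "\<dots> \<le> (real (Suc (card J')) * \<delta>) * (C * v t)"
        using \<delta> p1[of best t] p[of t best] by (intro mult_mono v_lower) auto
      also have "\<dots> = \<alpha> / (2 * \<gamma>) * v t"
        using pos by (simp only: \<delta>_def) (simp del: of_nat_Suc)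
      finally show ?thesis .
    qed
    ultimately have "(1 - p t best) * (\<Sum>j | k < j. p t j) \<le> (\<Sum>j\<in>J. p t j) + \<alpha> / (2 * \<gamma>) * v t"
      unfolding split distrib_left by linarith
    then have "\<gamma> * ((1 - p t best) * (\<Sum>j | k < j. p t j)) \<le> \<gamma> * ((\<Sum>j\<in>J. p t j) + \<alpha> / (2 * \<gamma>) * v t)"
      using pos by (intro mult_left_mono) auto
    also have "\<dots> = s t + \<alpha> / 2 * v t" using pos by (simp add: s_def field_simps)
    finally show ?case using lower[of t] by (simp add: field_simps)
  qed
  \<comment> \<open>The drift bound holds only eventually. This error makes it hold at every time
    and differs from \<open>s\<close> at finitely many times, so it stays summable.\<close>
  define s' where "s' t = max (s t) (\<alpha> / 2 * v t - \<mu> t)" for t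
  have s': "summable s'"
  proof -
    have "\<forall>\<^sub>F t in sequentially. s' t = s t"
      using ev by eventually_elim (auto simp: s'_def)
    then show ?thesis using s(1) summable_cong by blast
  qed
  have s'_nonneg: "s' t \<ge> 0" for t using s(2)[of t] by (simp add: s'_def)
  \<comment> \<open>Allowing fluctuations of \<open>\<alpha> / 4\<close> times the variance leaves
    half of the drift coefficient \<open>\<alpha> / 2\<close>.\<close>
  obtain K where K: "\<And>t. \<bar>D t - D 0 - (\<Sum>s<t. \<mu> s)\<bar> \<le> \<alpha> / 4 * (\<Sum>s<t. v s) + K"
    using conc[of "\<alpha> / 4"] pos by auto
  have D_lower: "D 0 - K - suminf s' + \<alpha> / 4 * (\<Sum>s<t. v s) \<le> D t" for t
  proof -
    have "(\<Sum>i<t. \<alpha> / 2 * v i - s' i) \<le> (\<Sum>i<t. \<mu> i)"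
      by (intro sum_mono) (simp add: s'_def)
    then have "\<alpha> / 2 * (\<Sum>i<t. v i) - (\<Sum>i<t. s' i) \<le> (\<Sum>i<t. \<mu> i)"
      by (simp add: sum_subtractf sum_distrib_left)
    moreover have "(\<Sum>i<t. s' i) \<le> suminf s'"
      by (intro sum_le_suminf s') (auto simp: s'_nonneg)
    ultimately show ?thesis using K[of t] by linarith
  qed
  show ?thesis
  proof (cases "summable v")
    case True
    \<comment> \<open>The total drift is at most \<open>C * suminf v\<close> in absolute value, and
      the fluctuations add \<open>\<alpha> / 4 * suminf v\<close> and \<open>K\<close>.\<close>
    define L where "L = \<bar>D 0\<bar> + \<bar>K\<bar> + (C + \<alpha> / 4) * suminf v"
    have D_bound: "\<bar>D t\<bar> \<le> L" for t
    proof -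
      have "\<bar>\<Sum>i<t. \<mu> i\<bar> \<le> (\<Sum>i<t. C * v i)"
        by (intro order_trans[OF sum_abs] sum_mono \<mu>_abs)
      then have "\<bar>\<Sum>i<t. \<mu> i\<bar> \<le> C * (\<Sum>i<t. v i)" by (simp add: sum_distrib_left)
      moreover have "(C + \<alpha> / 4) * (\<Sum>i<t. v i) \<le> (C + \<alpha> / 4) * suminf v"
        using pos v0 True by (intro mult_left_mono sum_le_suminf) auto
      ultimately show ?thesis using K[of t] by (simp add: L_def algebra_simps)
    qed
    have "p t k \<le> exp L * (1 + exp L) * C * v t" for t
    proof -
      \<comment> \<open>Adding \<open>p t best * (1 - p t best)\<close> to both sides turns this
        into a bound of \<open>p t best\<close> itself by a multiple of that product, hence of
        \<open>v t\<close>.\<close>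
      have "p t best * p t best \<le> exp L * (1 - p t best) * p t best"
      proof (rule mult_right_mono)
        have "p t best = exp (D t) * p t k" by (simp add: D flip: exp_add)
        also have "\<dots> \<le> exp L * p t k"
          using D_bound[of t] p[of t k] by (intro mult_right_mono) (auto simp: abs_le_iff)
        also have "\<dots> \<le> exp L * (1 - p t best)"
          using p_le[OF k, of t] by (intro mult_left_mono) auto
        finally show "p t best \<le> exp L * (1 - p t best)" .
      qed (simp add: p less_imp_le)
      then have "p t best \<le> (1 + exp L) * (p t best * (1 - p t best))"
        by (simp add: algebra_simps)
      also have "\<dots> \<le> (1 + exp L) * (C * v t)"
        by (intro mult_left_mono v_lower) (simp add: add_nonneg_nonneg)
      finally have "exp L * p t best \<le> exp L * ((1 + exp L) * (C * v t))"
        by (intro mult_left_mono) auto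
      moreover have "p t k \<le> exp L * p t best"
        unfolding D using D_bound[of t] p[of t best] by (simp add: mult.commute abs_le_iff)
      ultimately show ?thesis unfolding mult.assoc by linarith
    qed
    moreover have "summable (\<lambda>t. exp L * (1 + exp L) * C * v t)"
      by (rule summable_mult[OF True])
    ultimately have "summable (\<lambda>t. p t k)"
      using p by (intro summable_comparison_test'[where N = 0 and f = "\<lambda>t. p t k"
          and g = "\<lambda>t. exp L * (1 + exp L) * C * v t"]) (auto simp: less_imp_le)
    then show ?thesis ..
  next
    case False
    have "filterlim (\<lambda>t. \<Sum>s<t. v s) at_top sequentially"
      unfolding filterlim_at_top
    proof (rule ccontr)
      assume "\<not> (\<forall>Z. \<forall>\<^sub>F t in sequentially. Z \<le> (\<Sum>s<t. v s))"
      then obtain Z where Z: "\<not> (\<forall>\<^sub>F t in sequentially. Z \<le> (\<Sum>s<t. v s))" by blast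
      \<comment> \<open>The partial sums are monotone, so a single value above \<open>Z\<close>
        would keep all later ones above \<open>Z\<close>.\<close>
      have "(\<Sum>s<t. v s) \<le> Z" for t
      proof (rule ccontr)
        assume "\<not> (\<Sum>s<t. v s) \<le> Z"
        then have "Z \<le> (\<Sum>s<u. v s)" if "t \<le> u" for u
          using sum_mono2[of "{..<u}" "{..<t}" v] that v0 by (force simp: not_le)
        then show False using Z eventually_sequentially by blast
      qed
      then have "summable v" by (intro summableI_nonneg_bounded[of _ Z] v0)
      with False show False by simp
    qed
    then have "filterlim (\<lambda>t. D 0 - K - suminf s' + \<alpha> / 4 * (\<Sum>s<t. v s)) at_top sequentially"
      using pos by (intro filterlim_tendsto_add_at_top[OF tendsto_const]
          filterlim_tendsto_pos_mult_at_top[OF tendsto_const]) auto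
    then have "filterlim D at_top sequentially"
      by (rule filterlim_at_top_mono) (rule always_eventually, rule allI, rule D_lower)
    then have "(\<lambda>t. exp (- D t)) \<longlonglongrightarrow> 0"
      by (intro filterlim_compose[OF exp_at_bot]) (simp add: filterlim_uminus_at_bot_at_top filterlim_compose[OF filterlim_uminus_at_bot_at_top])
    moreover have "p t k / p t best = exp (- D t)" for t
      using p[of t best] by (simp add: D)
    ultimately show ?thesis by simp
  qed
qed

section \<open>The softmax policy gradient process\<close>

lemma policy_eq:
  "policy X \<theta> $ a = exp (X $ a \<bullet> \<theta>) / (\<Sum>b\<in>UNIV. exp (X $ b \<bullet> \<theta>))"
  by (simp add: policy_def softmax_def matrix_vector_mul_component)

lemma policy_pos: "policy X \<theta> $ a > 0"
  unfolding policy_eq by (intro divide_pos_pos sum_pos) auto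

lemma sum_policy: "(\<Sum>a\<in>UNIV. policy X \<theta> $ a) = 1"
proof -
  have "(\<Sum>b\<in>UNIV. exp (X $ b \<bullet> \<theta>)) > 0" by (intro sum_pos) auto
  then show ?thesis by (simp add: policy_eq flip: sum_divide_distrib)
qed

lemma policy_le_1: "policy X \<theta> $ a \<le> 1"
  using member_le_sum[of a UNIV "\<lambda>a. policy X \<theta> $ a"] policy_pos[of X]
  by (simp add: sum_policy less_imp_le)

lemma policy_measurable[measurable]: "(\<lambda>\<theta>. policy X \<theta> $ a) \<in> borel_measurable borel"
  unfolding policy_eq by measurable

text \<open>The normalizing sum cancels, so log-ratios of action probabilities are linear in the
  parameter.\<close>

lemma policy_ratio:
  "policy X \<theta> $ k = policy X \<theta> $ a * exp (- ((X $ a - X $ k) \<bullet> \<theta>))"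
  by (simp add: policy_eq inner_diff_left flip: exp_add)

lemma transpose_mult_vec_eq_sum: "transpose X *v w = (\<Sum>i\<in>UNIV. w $ i *\<^sub>R X $ i)"
  for X :: "real^'d^'k::finite"
  by (simp add: vec_eq_iff vector_matrix_mult_def mult.commute)

text \<open>The importance weight 1/\<pi>(a) cancels against the factor \<pi>(a) in column
  \<open>a\<close> of the softmax Jacobian. Hence bounded rewards give uniformly bounded steps,
  although the reward estimate itself is unbounded.\<close>

lemma spg_update_eq:
  "spg_update X \<eta> \<theta> a \<rho> =
    \<theta> + (\<eta> * \<rho>) *\<^sub>R (X $ a - (\<Sum>b\<in>UNIV. policy X \<theta> $ b *\<^sub>R X $ b))"
proof -
  define p where "p = policy X \<theta>"
  have p: "p $ b \<noteq> 0" for b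
    using policy_pos[of X \<theta> b] by (simp add: p_def)
  have est: "((diag_matrix p - outer_product p p) *v reward_estimate p a \<rho>) $ i
      = \<rho> * ((if i = a then 1 else 0) - p $ i)" for i
  proof -
    have "((diag_matrix p - outer_product p p) *v reward_estimate p a \<rho>) $ i
        = (\<Sum>j\<in>UNIV. if j = a then ((if i = a then p $ i else 0) - p $ i * p $ a) / p $ a * \<rho> else 0)"
      by (simp only: matrix_vector_mult_def diag_matrix_def outer_product_def reward_estimate_def
          vec_lambda_beta vector_minus_component) (intro sum.cong refl, auto)
    then show ?thesis using p[of a] by (cases "i = a") (simp_all add: diff_divide_distrib algebra_simps)
  qed
  have "(\<Sum>i\<in>UNIV. (\<rho> * ((if i = a then 1 else 0) - p $ i)) *\<^sub>R X $ i)
      = \<rho> *\<^sub>R ((\<Sum>i\<in>UNIV. if i = a then X $ i else 0) - (\<Sum>i\<in>UNIV. p $ i *\<^sub>R X $ i))"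
    unfolding sum_subtractf[symmetric] scaleR_right.sum
    by (intro sum.cong refl) (simp add: algebra_simps)
  then show ?thesis
    unfolding spg_update_def Let_def transpose_mult_vec_eq_sum p_def[symmetric] est by simp
qed

lemma spg_update_measurable:
  assumes [measurable]: "\<theta> \<in> borel_measurable N" "act \<in> measurable N (count_space UNIV)"
    "rew \<in> borel_measurable N"
  shows "(\<lambda>\<omega>. spg_update X \<eta> (\<theta> \<omega>) (act \<omega>) (rew \<omega>)) \<in> borel_measurable N"
proof -
  have [measurable]: "(\<lambda>\<omega>. X $ act \<omega>) \<in> borel_measurable N"
    by (rule measurable_compose[OF assms(2)]) simp
  show ?thesis unfolding spg_update_eq by measurable
qed

section \<open>Measurability and conditional laws of actions and rewards\<close>

locale softmax_pg = prob_space M for M :: "'w measure" +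
  fixes P :: "'k::{finite,linorder} \<Rightarrow> real measure"
    and \<nu> :: "real measure"
    and X :: "real^'d^'k::{finite,linorder}"
    and R_max \<eta> :: real
    and \<theta>\<^sub>1 :: "real^'d"
    and act :: "nat \<Rightarrow> 'w \<Rightarrow> 'k"
    and rew :: "nat \<Rightarrow> 'w \<Rightarrow> real"
    and \<theta> :: "nat \<Rightarrow> 'w \<Rightarrow> real^'d"
  assumes R_max_pos: "R_max > 0"
    and reward: "reward_model R_max \<nu> P"
    and \<eta>_pos: "\<eta> > 0"
    and process: "softmax_pg_process M P X \<eta> \<theta>\<^sub>1 act rew \<theta>"
begin

lemma act_measurable[measurable]: "t \<ge> 1 \<Longrightarrow> act t \<in> measurable M (count_space UNIV)"
  and rew_measurable[measurable]: "t \<ge> 1 \<Longrightarrow> rew t \<in> borel_measurable M"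
  and \<theta>_1: "\<omega> \<in> space M \<Longrightarrow> \<theta> 1 \<omega> = \<theta>\<^sub>1"
  and \<theta>_Suc: "t \<ge> 1 \<Longrightarrow> \<omega> \<in> space M \<Longrightarrow>
    \<theta> (Suc t) \<omega> = spg_update X \<eta> (\<theta> t \<omega>) (act t \<omega>) (rew t \<omega>)"
  and cond_act: "t \<ge> 1 \<Longrightarrow> AE \<omega> in M.
    real_cond_exp M (past M act rew t) (indicator {\<omega> \<in> space M. act t \<omega> = a}) \<omega>
      = policy X (\<theta> t \<omega>) $ a"
  and cond_rew: "t \<ge> 1 \<Longrightarrow> B \<in> sets borel \<Longrightarrow> AE \<omega> in M.
    real_cond_exp M (past_action M act rew t) (indicator {\<omega> \<in> space M. rew t \<omega> \<in> B}) \<omega>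
      = measure (P (act t \<omega>)) B"
  using process unfolding softmax_pg_process_def by blast+

text \<open>Concentration on the interval passes from \<nu> to \<open>P a\<close> by absolute
  continuity.\<close>

lemma prob_space_P: "prob_space (P a)"
  and sets_P[measurable_cong]: "sets (P a) = sets borel"
  and measure_P_outside: "measure (P a) (- {-R_max..R_max}) = 0"
proof -
  obtain f where f: "f \<in> borel_measurable borel" "P a = density \<nu> (\<lambda>x. ennreal (f x))"
    and \<nu>: "sets \<nu> = sets borel" "emeasure \<nu> (- {-R_max..R_max}) = 0"
    and prob: "prob_space (P a)"
    using reward unfolding reward_model_def by blast
  note [measurable_cong] = \<nu>(1)
  show "prob_space (P a)" by fact
  show "sets (P a) = sets borel" using f \<nu> by simp
  have null: "- {-R_max..R_max} \<in> null_sets \<nu>" using \<nu> by (auto simp: null_sets_def)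
  have "(\<lambda>x. ennreal (f x)) \<in> borel_measurable \<nu>"
    using f(1) by measurable
  then have "- {-R_max..R_max} \<in> null_sets (P a)"
    unfolding f(2) using absolutely_continuousI_density[of "\<lambda>x. ennreal (f x)" \<nu>] null
    by (auto simp: absolutely_continuous_def)
  then show "measure (P a) (- {-R_max..R_max}) = 0"
    by (simp add: null_sets_def measure_def)
qed

lemma subalg_past: "subalgebra M (past M act rew t)"
  by (rule subalgebra_past) auto

lemma subalg_past_action: "t \<ge> 1 \<Longrightarrow> subalgebra M (past_action M act rew t)"
  by (rule subalgebra_past_action) auto

lemma space_past[simp]: "space (past M act rew t) = space M"
  by (simp add: past_def)

lemma observations_measurable_past:
  "observations act rew t \<in> measurable (past M act rew t) (observation_space t)"
proof -
  have "observations act rew t \<in> measurable M (observation_space t)"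
    by (rule observations_measurable) auto
  then show ?thesis
    unfolding past_def by (intro measurable_vimage_algebra1 measurable_space[THEN Pi_I]) auto
qed

lemma observation_measurable_past:
  assumes "1 \<le> s" "s < t"
  shows "(\<lambda>\<omega>. (act s \<omega>, rew s \<omega>)) \<in> measurable (past M act rew t) (count_space UNIV \<Otimes>\<^sub>M borel)"
proof -
  have "(\<lambda>\<omega>. observations act rew t \<omega> s) \<in> measurable (past M act rew t) (count_space UNIV \<Otimes>\<^sub>M borel)"
    using measurable_compose[OF observations_measurable_past measurable_component_singleton, of s] assms by simp
  then show ?thesis using assms by (simp add: observations_def)
qed

lemma act_measurable_past: "1 \<le> s \<Longrightarrow> s < t \<Longrightarrow> act s \<in> measurable (past M act rew t) (count_space UNIV)"
  using measurable_compose[OF observation_measurable_past measurable_fst, of s t] by simp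

lemma rew_measurable_past: "1 \<le> s \<Longrightarrow> s < t \<Longrightarrow> rew s \<in> borel_measurable (past M act rew t)"
  using measurable_compose[OF observation_measurable_past measurable_snd, of s t] by simp

lemma past_mono: "subalgebra (past M act rew (Suc t)) (past M act rew t)"
proof -
  have "observations act rew t \<in> measurable (past M act rew (Suc t)) (observation_space t)"
    unfolding observations_def
    by (intro measurable_restrict observation_measurable_past) auto
  then show ?thesis
    unfolding subalgebra_def
    by (auto simp: past_def[of M act rew t] dest!: sets_image_in_sets[rotated])
qed

lemma past_subset_past_action: "t \<ge> 1 \<Longrightarrow> sets (past M act rew t) \<subseteq> sets (past_action M act rew t)"
  and act_set_past_action: "t \<ge> 1 \<Longrightarrow> {\<omega> \<in> space M. act t \<omega> = a} \<in> sets (past_action M act rew t)"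
proof -
  assume t: "t \<ge> 1"
  have "observations act rew t \<in> measurable M (observation_space t)"
    by (rule observations_measurable) auto
  then have "(\<lambda>\<omega>. (observations act rew t \<omega>, act t \<omega>)) \<in>
      measurable M (observation_space t \<Otimes>\<^sub>M count_space UNIV)"
    using t by measurable
  then have pair: "(\<lambda>\<omega>. (observations act rew t \<omega>, act t \<omega>)) \<in>
      measurable (past_action M act rew t) (observation_space t \<Otimes>\<^sub>M count_space UNIV)"
    unfolding past_action_def by (intro measurable_vimage_algebra1 measurable_space[THEN Pi_I]) auto
  have sp: "space (past_action M act rew t) = space M"
    by (simp add: past_action_def)
  have "observations act rew t \<in> measurable (past_action M act rew t) (observation_space t)"
    using measurable_compose[OF pair measurable_fst] by simp
  then show "sets (past M act rew t) \<subseteq> sets (past_action M act rew t)"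
    using sp by (auto simp: past_def dest!: sets_image_in_sets[rotated])
  have "act t \<in> measurable (past_action M act rew t) (count_space UNIV)"
    using measurable_compose[OF pair measurable_snd] by simp
  from measurable_sets[OF this, of "{a}"] show "{\<omega> \<in> space M. act t \<omega> = a} \<in> sets (past_action M act rew t)"
    by (simp add: sp vimage_def Int_def conj_commute)
qed

lemma \<theta>_measurable_past: "t \<ge> 1 \<Longrightarrow> \<theta> t \<in> borel_measurable (past M act rew t)"
proof (induction t rule: dec_induct)
  case base
  then show ?case using measurable_cong[of "past M act rew 1" "\<theta> 1" "\<lambda>_. \<theta>\<^sub>1" borel] \<theta>_1 by simp
next
  case (step t)
  have "(\<lambda>\<omega>. spg_update X \<eta> (\<theta> t \<omega>) (act t \<omega>) (rew t \<omega>)) \<in> borel_measurable (past M act rew (Suc t))"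
    using step by (intro spg_update_measurable act_measurable_past rew_measurable_past
        measurable_from_subalg[OF past_mono]) auto
  then show ?case
    by (subst measurable_cong[OF \<theta>_Suc]) (use step in auto)
qed

text \<open>The probability of a reward outside the interval is the mean of its conditional
  probability, which vanishes for every action.\<close>

lemma AE_rew_bounded:
  assumes t: "t \<ge> 1"
  shows "AE \<omega> in M. \<bar>rew t \<omega>\<bar> \<le> R_max"
proof -
  interpret S: finite_measure_subalgebra M "past_action M act rew t"
    by unfold_locales (rule subalg_past_action[OF t])
  define N where "N = {\<omega> \<in> space M. rew t \<omega> \<in> - {-R_max..R_max}}"
  have N[measurable]: "N \<in> sets M" unfolding N_def using t by measurable
  have "measure M N = (\<integral>\<omega>. indicator N \<omega> \<partial>M)" by simp
  also have "\<dots> = (\<integral>\<omega>. real_cond_exp M (past_action M act rew t) (indicator N) \<omega> \<partial>M)"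
    by (rule S.real_cond_exp_int(2)[symmetric]) (auto simp: less_top[symmetric])
  also have "\<dots> = 0"
    by (rule integral_eq_zero_AE) (use cond_rew[OF t, of "- {-R_max..R_max}"] in \<open>auto simp: N_def measure_P_outside\<close>)
  finally have "N \<in> null_sets M" by (auto simp: null_sets_def emeasure_eq_measure)
  from AE_not_in[OF this] AE_space show ?thesis
    by eventually_elim (auto simp: N_def abs_le_iff)
qed

text \<open>The sampling rule speaks only of events for the reward. It is lifted to an equality of
  measures, from which the mean follows by integrating the identity.\<close>

lemma integral_reward_on_past_action:
  assumes t: "t \<ge> 1" and G: "G \<in> sets (past_action M act rew t)"
    and act_G: "\<And>\<omega>. \<omega> \<in> G \<Longrightarrow> act t \<omega> = a"
  shows "(\<integral>\<omega>. indicator G \<omega> * rew t \<omega> \<partial>M) = measure M G * mean_reward P a"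
proof -
  interpret S: finite_measure_subalgebra M "past_action M act rew t"
    by unfold_locales (rule subalg_past_action[OF t])
  interpret Pa: prob_space "P a" by (rule prob_space_P)
  have GM[measurable]: "G \<in> sets M"
    using G subalg_past_action[OF t] by (auto simp: subalgebra_def)
  note [measurable] = rew_measurable[OF t]
  have eq: "measure M (G \<inter> {\<omega> \<in> space M. rew t \<omega> \<in> B}) = measure M G * measure (P a) B"
    if B[measurable]: "B \<in> sets borel" for B
  proof -
    let ?R = "{\<omega> \<in> space M. rew t \<omega> \<in> B}"
    have int: "integrable M (\<lambda>\<omega>. indicator G \<omega> * indicator ?R \<omega> :: real)"
      unfolding indicator_inter_arith[symmetric] by (rule integrable_real_indicator) (auto simp: less_top[symmetric])
    have "measure M (G \<inter> ?R) = (\<integral>\<omega>. indicator G \<omega> * indicator ?R \<omega> \<partial>M)"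
      unfolding indicator_inter_arith[symmetric] by simp
    also have "\<dots> = (\<integral>\<omega>. indicator G \<omega> * real_cond_exp M (past_action M act rew t) (indicator ?R) \<omega> \<partial>M)"
      by (rule S.real_cond_exp_intg(2)[symmetric]) (use int G in \<open>auto intro: borel_measurable_indicator\<close>)
    also have "\<dots> = (\<integral>\<omega>. indicator G \<omega> * measure (P a) B \<partial>M)"
    proof (rule integral_cong_AE)
      show "AE \<omega> in M. indicator G \<omega> * real_cond_exp M (past_action M act rew t) (indicator ?R) \<omega>
          = indicator G \<omega> * measure (P a) B"
        using cond_rew[OF t B] by eventually_elim (auto simp: indicator_def act_G)
    qed (auto intro!: borel_measurable_times borel_measurable_indicator)
    finally show ?thesis by simp
  qed
  \<comment> \<open>Restricted to \<open>G\<close>, the reward is distributed as \<open>P a\<close>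
    scaled by the probability of \<open>G\<close>.\<close>
  have "distr (density M (indicator G)) borel (rew t) = density (P a) (\<lambda>_. ennreal (measure M G))"
  proof (rule measure_eqI)
    fix B assume "B \<in> sets (distr (density M (indicator G)) borel (rew t))"
    then have [measurable]: "B \<in> sets borel" by simp
    have "emeasure (distr (density M (indicator G)) borel (rew t)) B
        = emeasure M (G \<inter> {\<omega> \<in> space M. rew t \<omega> \<in> B})"
      by (subst emeasure_distr)
        (auto simp: emeasure_restricted intro!: arg_cong[where f = "emeasure M"])
    also have "\<dots> = emeasure (density (P a) (\<lambda>_. ennreal (measure M G))) B"
      using eq[of B] by (simp add: emeasure_density_const sets_P emeasure_eq_measure Pa.emeasure_eq_measure ennreal_mult)
    finally show "emeasure (distr (density M (indicator G)) borel (rew t)) B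
        = emeasure (density (P a) (\<lambda>_. ennreal (measure M G))) B" .
  qed (simp add: sets_P)
  then have "(\<integral>x. x \<partial>distr (density M (indicator G)) borel (rew t))
      = (\<integral>x. x \<partial>density (P a) (\<lambda>_. ennreal (measure M G)))" by simp
  moreover have "(\<integral>x. x \<partial>distr (density M (indicator G)) borel (rew t)) = (\<integral>\<omega>. indicator G \<omega> * rew t \<omega> \<partial>M)"
  proof -
    have "density M (indicator G) = density M (\<lambda>\<omega>. ennreal (indicator G \<omega>))"
      by (rule density_cong) (auto simp: indicator_def)
    then show ?thesis by (subst integral_distr) (auto simp: integral_density)
  qed
  moreover have "(\<integral>x. x \<partial>density (P a) (\<lambda>_. ennreal (measure M G))) = measure M G * mean_reward P a"
    by (subst integral_density) (auto simp: mean_reward_def)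
  ultimately show ?thesis by simp
qed

text \<open>A tower argument on test events: for \<open>B\<close> in the past, intersecting with the
  choice of \<open>a\<close> gives an event of the finer algebra. There the reward integrates to its
  mean, and the remaining probability is governed by the law of the action.\<close>

lemma cond_exp_reward:
  assumes t: "t \<ge> 1"
  shows "AE \<omega> in M. real_cond_exp M (past M act rew t)
      (\<lambda>\<omega>. indicator {\<omega> \<in> space M. act t \<omega> = a} \<omega> * rew t \<omega>) \<omega>
    = policy X (\<theta> t \<omega>) $ a * mean_reward P a"
proof -
  interpret S: finite_measure_subalgebra M "past M act rew t"
    by unfold_locales (rule subalg_past)
  let ?A = "{\<omega> \<in> space M. act t \<omega> = a}"
  note [measurable] = rew_measurable[OF t] act_measurable[OF t]
  have [measurable]: "(\<lambda>\<omega>. policy X (\<theta> t \<omega>) $ a) \<in> borel_measurable (past M act rew t)"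
    using \<theta>_measurable_past[OF t] by measurable
  then have pM: "(\<lambda>\<omega>. policy X (\<theta> t \<omega>) $ a) \<in> borel_measurable M"
    by (rule measurable_from_subalg[OF subalg_past])
  have int_p: "integrable M (\<lambda>\<omega>. policy X (\<theta> t \<omega>) $ a)"
    by (rule integrable_const_bound[where B = 1])
      (use pM policy_le_1[of X] policy_pos[of X] in \<open>auto simp: less_imp_le abs_of_pos\<close>)
  show ?thesis
  proof (rule S.real_cond_exp_charact)
    show "integrable M (\<lambda>\<omega>. indicator ?A \<omega> * rew t \<omega>)"
      by (rule integrable_const_bound[where B = R_max])
        (use AE_rew_bounded[OF t] R_max_pos in \<open>auto simp: indicator_def elim: eventually_mono\<close>)
    show "integrable M (\<lambda>\<omega>. policy X (\<theta> t \<omega>) $ a * mean_reward P a)"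
      using int_p by simp
    show "(\<lambda>\<omega>. policy X (\<theta> t \<omega>) $ a * mean_reward P a) \<in> borel_measurable (past M act rew t)"
      by measurable
  next
    fix B assume B: "B \<in> sets (past M act rew t)"
    have BM[measurable]: "B \<in> sets M" using B subalg_past[of t] by (auto simp: subalgebra_def)
    have G: "B \<inter> ?A \<in> sets (past_action M act rew t)"
      using B past_subset_past_action[OF t] act_set_past_action[OF t] by blast
    have "(LINT \<omega>:B|M. indicator ?A \<omega> * rew t \<omega>) = (\<integral>\<omega>. indicator (B \<inter> ?A) \<omega> * rew t \<omega> \<partial>M)"
      unfolding set_lebesgue_integral_def by (simp add: indicator_inter_arith mult.assoc)
    also have "\<dots> = measure M (B \<inter> ?A) * mean_reward P a"
      by (rule integral_reward_on_past_action[OF t G]) auto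
    also have "measure M (B \<inter> ?A) = (\<integral>\<omega>. indicator B \<omega> * indicator ?A \<omega> \<partial>M)"
      by (simp flip: indicator_inter_arith)
    also have "\<dots> = (\<integral>\<omega>. indicator B \<omega> * real_cond_exp M (past M act rew t) (indicator ?A) \<omega> \<partial>M)"
      by (rule S.real_cond_exp_intg(2)[symmetric])
        (use B in \<open>auto simp: less_top[symmetric] simp flip: indicator_inter_arith intro: borel_measurable_indicator\<close>)
    also have "\<dots> = (\<integral>\<omega>. indicator B \<omega> * policy X (\<theta> t \<omega>) $ a \<partial>M)"
    proof (rule integral_cong_AE)
      show "AE \<omega> in M. indicator B \<omega> * real_cond_exp M (past M act rew t) (indicator ?A) \<omega>
          = indicator B \<omega> * policy X (\<theta> t \<omega>) $ a"
        using cond_act[OF t, of a] by eventually_elim simp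
    qed (use pM in \<open>auto intro!: borel_measurable_times borel_measurable_indicator\<close>)
    finally show "(LINT \<omega>:B|M. indicator ?A \<omega> * rew t \<omega>)
        = (LINT \<omega>:B|M. policy X (\<theta> t \<omega>) $ a * mean_reward P a)"
      by (simp add: set_lebesgue_integral_def mult.assoc flip: integral_mult_left_zero)
  qed
qed

section \<open>Concentration of the parameter along a fixed direction\<close>

text \<open>Here \<mu> is the exact conditional mean of the increment, whereas \<open>v\<close> only
  bounds its conditional second moment, the squared reward being replaced by
  \<open>R_max\<^sup>2\<close>. Time is shifted by one because the process starts at index
  1.\<close>

lemma AE_direction_concentration:
  fixes u :: "real^'d" and D \<mu> v :: "nat \<Rightarrow> 'w \<Rightarrow> real"
  defines "D \<equiv> \<lambda>t \<omega>. u \<bullet> \<theta> (Suc t) \<omega>"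
    and "\<mu> \<equiv> \<lambda>t \<omega>. let p = policy X (\<theta> (Suc t) \<omega>) in
      \<eta> * (\<Sum>a\<in>UNIV. p $ a * mean_reward P a * (X $ a \<bullet> u - (\<Sum>b\<in>UNIV. p $ b * (X $ b \<bullet> u))))"
    and "v \<equiv> \<lambda>t \<omega>. let p = policy X (\<theta> (Suc t) \<omega>) in
      \<eta>\<^sup>2 * R_max\<^sup>2 * (\<Sum>a\<in>UNIV. p $ a * (X $ a \<bullet> u - (\<Sum>b\<in>UNIV. p $ b * (X $ b \<bullet> u)))\<^sup>2)"
  shows "AE \<omega> in M. \<forall>\<epsilon>>0. \<exists>K. \<forall>t.
    \<bar>D t \<omega> - D 0 \<omega> - (\<Sum>s<t. \<mu> s \<omega>)\<bar> \<le> \<epsilon> * (\<Sum>s<t. v s \<omega>) + K"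
proof -
  \<comment> \<open>The past at \<open>Suc t\<close> contains the rounds 1 to \<open>t\<close>,
    which is what determines the parameter with index \<open>Suc t\<close>.\<close>
  define F where "F t = past M act rew (Suc t)" for t
  define p where "p t \<omega> a = policy X (\<theta> (Suc t) \<omega>) $ a" for t \<omega> a
  define y where "y a = X $ a \<bullet> u" for a
  define c where "c t \<omega> a = \<eta> * (y a - (\<Sum>b\<in>UNIV. p t \<omega> b * y b))" for t \<omega> a
  define A where "A t a = {\<omega> \<in> space M. act (Suc t) \<omega> = a}" for t a
  \<comment> \<open>The factor 2 accounts for both the feature value and its policy average.\<close>
  define L where "L = \<eta> * (2 * (\<Sum>a\<in>UNIV. \<bar>y a\<bar>))"
  have p01: "0 \<le> p t \<omega> a" "p t \<omega> a \<le> 1" for t \<omega> a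
    using policy_pos[of X] policy_le_1[of X] by (simp_all add: p_def less_imp_le)
  have L: "L \<ge> 0" unfolding L_def using \<eta>_pos by (auto intro!: sum_nonneg mult_nonneg_nonneg)
  have c_bound: "\<bar>c t \<omega> a\<bar> \<le> L" for t \<omega> a
  proof -
    have "\<bar>\<Sum>b\<in>UNIV. p t \<omega> b * y b\<bar> \<le> (\<Sum>b\<in>UNIV. \<bar>y b\<bar>)"
      using p01 by (intro order_trans[OF sum_abs] sum_mono) (auto simp: abs_mult intro: mult_left_le_one_le)
    moreover have "\<bar>y a\<bar> \<le> (\<Sum>b\<in>UNIV. \<bar>y b\<bar>)"
      by (rule member_le_sum) auto
    ultimately have "\<bar>y a - (\<Sum>b\<in>UNIV. p t \<omega> b * y b)\<bar> \<le> 2 * (\<Sum>b\<in>UNIV. \<bar>y b\<bar>)"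
      by linarith
    then show ?thesis unfolding c_def L_def abs_mult using \<eta>_pos by (intro mult_mono) auto
  qed
  have sub: "subalgebra M (F t)" for t unfolding F_def by (rule subalg_past)
  have filt: "subalgebra (F (Suc t)) (F t)" for t unfolding F_def by (rule past_mono)
  have [measurable]: "\<theta> (Suc t) \<in> borel_measurable (F t)" for t
    unfolding F_def by (rule \<theta>_measurable_past) simp
  have p_F[measurable]: "(\<lambda>\<omega>. p t \<omega> a) \<in> borel_measurable (F t)" for t a
    unfolding p_def by measurable
  have c_F[measurable]: "(\<lambda>\<omega>. c t \<omega> a) \<in> borel_measurable (F t)" for t a
    unfolding c_def by measurable
  have c_M[measurable]: "(\<lambda>\<omega>. c t \<omega> a) \<in> borel_measurable M" for t a
    by (rule measurable_from_subalg[OF sub c_F])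
  have A_M[measurable]: "A t a \<in> sets M" for t a unfolding A_def by measurable
  have [measurable]: "rew (Suc t) \<in> borel_measurable M" for t by measurable
  have D_F[measurable]: "D t \<in> borel_measurable (F t)" for t
    unfolding D_def by measurable
  have D_M[measurable]: "D t \<in> borel_measurable M" for t
    by (rule measurable_from_subalg[OF sub D_F])
  have \<mu>_eq: "\<mu> t \<omega> = (\<Sum>a\<in>UNIV. c t \<omega> a * (p t \<omega> a * mean_reward P a))" for t \<omega>
    unfolding \<mu>_def c_def p_def y_def Let_def sum_distrib_left
    by (intro sum.cong refl) (simp only: mult_ac)
  have v_eq: "v t \<omega> = (\<Sum>a\<in>UNIV. (c t \<omega> a)\<^sup>2 * R_max\<^sup>2 * p t \<omega> a)" for t \<omega>
    unfolding v_def c_def p_def y_def Let_def sum_distrib_left power_mult_distrib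
    by (intro sum.cong refl) (simp only: mult_ac)
  have increment: "D (Suc t) \<omega> - D t \<omega> = c t \<omega> (act (Suc t) \<omega>) * rew (Suc t) \<omega>"
    if "\<omega> \<in> space M" for t \<omega>
  proof -
    have "\<theta> (Suc (Suc t)) \<omega> = spg_update X \<eta> (\<theta> (Suc t) \<omega>) (act (Suc t) \<omega>) (rew (Suc t) \<omega>)"
      using \<theta>_Suc[of "Suc t" \<omega>] that by simp
    then show ?thesis
      by (simp add: D_def spg_update_eq c_def p_def y_def inner_add_right inner_diff_right
          inner_sum_right inner_commute)
  qed
  \<comment> \<open>Splitting by the chosen action separates coefficients known from the past from
    the terms whose conditional means are known.\<close>
  have increment_sum: "D (Suc t) \<omega> - D t \<omega> = (\<Sum>a\<in>UNIV. c t \<omega> a * (indicator (A t a) \<omega> * rew (Suc t) \<omega>))"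
    if "\<omega> \<in> space M" for t \<omega>
  proof -
    have "(\<Sum>a\<in>UNIV. c t \<omega> a * (indicator (A t a) \<omega> * rew (Suc t) \<omega>))
        = (\<Sum>a\<in>UNIV. if a = act (Suc t) \<omega> then c t \<omega> a * rew (Suc t) \<omega> else 0)"
      by (intro sum.cong refl) (auto simp: A_def that)
    then show ?thesis by (simp add: increment[OF that])
  qed
  have square_le: "(D (Suc t) \<omega> - D t \<omega>)\<^sup>2 \<le> (\<Sum>a\<in>UNIV. ((c t \<omega> a)\<^sup>2 * R_max\<^sup>2) * indicator (A t a) \<omega>)"
    if "\<omega> \<in> space M" "\<bar>rew (Suc t) \<omega>\<bar> \<le> R_max" for t \<omega>
  proof -
    have "(\<Sum>a\<in>UNIV. ((c t \<omega> a)\<^sup>2 * R_max\<^sup>2) * indicator (A t a) \<omega>)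
        = (\<Sum>a\<in>UNIV. if a = act (Suc t) \<omega> then (c t \<omega> a)\<^sup>2 * R_max\<^sup>2 else 0)"
      by (intro sum.cong refl) (auto simp: A_def that)
    also have "\<dots> = (c t \<omega> (act (Suc t) \<omega>))\<^sup>2 * R_max\<^sup>2" by simp
    finally show ?thesis
      using that(2) R_max_pos
      by (simp add: increment[OF that(1)] power_mult_distrib mult_left_mono flip: abs_le_square_iff)
  qed
  have bound: "AE \<omega> in M. \<bar>D (Suc t) \<omega> - D t \<omega>\<bar> \<le> L * R_max" for t
    using AE_space AE_rew_bounded[of "Suc t", simplified]
  proof eventually_elim
    case (elim \<omega>)
    then show ?case
      unfolding increment[OF elim(1)] abs_mult using L by (intro mult_mono c_bound) auto
  qed
  have \<mu>_bound: "\<bar>\<mu> t \<omega>\<bar> \<le> (\<Sum>a\<in>UNIV. L * \<bar>mean_reward P a\<bar>)" for t \<omega>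
    unfolding \<mu>_eq
  proof (rule order_trans[OF sum_abs], rule sum_mono)
    fix a
    have "\<bar>p t \<omega> a\<bar> * \<bar>mean_reward P a\<bar> \<le> \<bar>mean_reward P a\<bar>"
      using p01 by (intro mult_left_le_one_le) auto
    then show "\<bar>c t \<omega> a * (p t \<omega> a * mean_reward P a)\<bar> \<le> L * \<bar>mean_reward P a\<bar>"
      unfolding abs_mult using L by (intro mult_mono c_bound) auto
  qed
  have rew_int: "integrable M (\<lambda>\<omega>. indicator (A t a) \<omega> * rew (Suc t) \<omega>)" for t a
    by (rule integrable_const_bound[where B = R_max])
      (use AE_rew_bounded[of "Suc t"] R_max_pos in \<open>auto simp: indicator_def elim: eventually_mono\<close>)
  have c_rew_int: "integrable M (\<lambda>\<omega>. c t \<omega> a * (indicator (A t a) \<omega> * rew (Suc t) \<omega>))" for t a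
  proof (rule integrable_const_bound[where B = "L * R_max"])
    show "AE \<omega> in M. norm (c t \<omega> a * (indicator (A t a) \<omega> * rew (Suc t) \<omega>)) \<le> L * R_max"
      using AE_rew_bounded[of "Suc t", simplified]
    proof eventually_elim
      case (elim \<omega>)
      then show ?case
        unfolding real_norm_def abs_mult using L R_max_pos
        by (intro mult_mono c_bound) (auto simp: indicator_def)
    qed
  qed measurable
  have c2_int: "integrable M (\<lambda>\<omega>. ((c t \<omega> a)\<^sup>2 * R_max\<^sup>2) * indicator (A t a) \<omega>)" for t a
  proof (rule integrable_const_bound[where B = "L\<^sup>2 * R_max\<^sup>2"])
    have "(c t \<omega> a)\<^sup>2 \<le> L\<^sup>2" for \<omega>
      using c_bound[of t \<omega> a] by (rule abs_le_square_iff[THEN iffD1, OF order_trans]) simp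
    then show "AE \<omega> in M. norm ((c t \<omega> a)\<^sup>2 * R_max\<^sup>2 * indicator (A t a) \<omega>) \<le> L\<^sup>2 * R_max\<^sup>2"
      by (auto simp: indicator_def intro!: mult_right_mono)
  qed measurable
  have first: "AE \<omega> in M. real_cond_exp M (F t) (\<lambda>\<omega>. D (Suc t) \<omega> - D t \<omega>) \<omega> = \<mu> t \<omega>" for t
  proof -
    interpret S: finite_measure_subalgebra M "F t"
      by unfold_locales (rule sub)
    have 1: "AE \<omega> in M. real_cond_exp M (F t) (\<lambda>\<omega>. D (Suc t) \<omega> - D t \<omega>) \<omega>
        = real_cond_exp M (F t) (\<lambda>\<omega>. \<Sum>a\<in>UNIV. c t \<omega> a * (indicator (A t a) \<omega> * rew (Suc t) \<omega>)) \<omega>"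
      by (rule S.real_cond_exp_cong) (auto simp: increment_sum)
    have 2: "AE \<omega> in M.
        real_cond_exp M (F t) (\<lambda>\<omega>. \<Sum>a\<in>UNIV. c t \<omega> a * (indicator (A t a) \<omega> * rew (Suc t) \<omega>)) \<omega>
        = (\<Sum>a\<in>UNIV. real_cond_exp M (F t) (\<lambda>\<omega>. c t \<omega> a * (indicator (A t a) \<omega> * rew (Suc t) \<omega>)) \<omega>)"
      by (rule S.real_cond_exp_sum) (rule c_rew_int)
    have 3: "AE \<omega> in M. \<forall>a\<in>UNIV.
        real_cond_exp M (F t) (\<lambda>\<omega>. c t \<omega> a * (indicator (A t a) \<omega> * rew (Suc t) \<omega>)) \<omega>
        = c t \<omega> a * (p t \<omega> a * mean_reward P a)"
    proof (rule AE_finite_allI)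
      fix a
      have "AE \<omega> in M. real_cond_exp M (F t) (\<lambda>\<omega>. c t \<omega> a * (indicator (A t a) \<omega> * rew (Suc t) \<omega>)) \<omega>
          = c t \<omega> a * real_cond_exp M (F t) (\<lambda>\<omega>. indicator (A t a) \<omega> * rew (Suc t) \<omega>) \<omega>"
        by (rule S.real_cond_exp_mult) (use c_rew_int in auto)
      moreover have "AE \<omega> in M. real_cond_exp M (F t) (\<lambda>\<omega>. indicator (A t a) \<omega> * rew (Suc t) \<omega>) \<omega>
          = p t \<omega> a * mean_reward P a"
        unfolding F_def A_def p_def by (rule cond_exp_reward) simp
      ultimately show "AE \<omega> in M.
          real_cond_exp M (F t) (\<lambda>\<omega>. c t \<omega> a * (indicator (A t a) \<omega> * rew (Suc t) \<omega>)) \<omega>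
          = c t \<omega> a * (p t \<omega> a * mean_reward P a)"
        by eventually_elim simp
    qed simp
    from 1 2 3 show ?thesis by eventually_elim (simp add: \<mu>_eq)
  qed
  have second: "AE \<omega> in M. real_cond_exp M (F t) (\<lambda>\<omega>. (D (Suc t) \<omega> - D t \<omega>)\<^sup>2) \<omega> \<le> v t \<omega>" for t
  proof -
    interpret S: finite_measure_subalgebra M "F t"
      by unfold_locales (rule sub)
    have 1: "AE \<omega> in M. real_cond_exp M (F t) (\<lambda>\<omega>. (D (Suc t) \<omega> - D t \<omega>)\<^sup>2) \<omega>
        \<le> real_cond_exp M (F t) (\<lambda>\<omega>. \<Sum>a\<in>UNIV. ((c t \<omega> a)\<^sup>2 * R_max\<^sup>2) * indicator (A t a) \<omega>) \<omega>"
    proof (rule S.real_cond_exp_mono)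
      show "AE \<omega> in M. (D (Suc t) \<omega> - D t \<omega>)\<^sup>2
          \<le> (\<Sum>a\<in>UNIV. ((c t \<omega> a)\<^sup>2 * R_max\<^sup>2) * indicator (A t a) \<omega>)"
        using AE_space AE_rew_bounded[of "Suc t", simplified]
        by eventually_elim (rule square_le)
      show "integrable M (\<lambda>\<omega>. (D (Suc t) \<omega> - D t \<omega>)\<^sup>2)"
      proof (rule integrable_const_bound[where B = "(L * R_max)\<^sup>2"])
        show "AE \<omega> in M. norm ((D (Suc t) \<omega> - D t \<omega>)\<^sup>2) \<le> (L * R_max)\<^sup>2"
          using bound[of t]
        proof eventually_elim
          case (elim \<omega>)
          then have "\<bar>D (Suc t) \<omega> - D t \<omega>\<bar> \<le> \<bar>L * R_max\<bar>" by linarith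
          then show ?case by (simp add: abs_le_square_iff)
        qed
      qed measurable
    qed (intro Bochner_Integration.integrable_sum c2_int)
    have 2: "AE \<omega> in M.
        real_cond_exp M (F t) (\<lambda>\<omega>. \<Sum>a\<in>UNIV. ((c t \<omega> a)\<^sup>2 * R_max\<^sup>2) * indicator (A t a) \<omega>) \<omega>
        = (\<Sum>a\<in>UNIV. real_cond_exp M (F t) (\<lambda>\<omega>. ((c t \<omega> a)\<^sup>2 * R_max\<^sup>2) * indicator (A t a) \<omega>) \<omega>)"
      by (rule S.real_cond_exp_sum) (rule c2_int)
    have 3: "AE \<omega> in M. \<forall>a\<in>UNIV.
        real_cond_exp M (F t) (\<lambda>\<omega>. ((c t \<omega> a)\<^sup>2 * R_max\<^sup>2) * indicator (A t a) \<omega>) \<omega>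
        = (c t \<omega> a)\<^sup>2 * R_max\<^sup>2 * p t \<omega> a"
    proof (rule AE_finite_allI)
      fix a
      have "AE \<omega> in M. real_cond_exp M (F t) (\<lambda>\<omega>. ((c t \<omega> a)\<^sup>2 * R_max\<^sup>2) * indicator (A t a) \<omega>) \<omega>
          = ((c t \<omega> a)\<^sup>2 * R_max\<^sup>2) * real_cond_exp M (F t) (indicator (A t a)) \<omega>"
        by (rule S.real_cond_exp_mult) (use c2_int in auto)
      moreover have "AE \<omega> in M. real_cond_exp M (F t) (indicator (A t a)) \<omega> = p t \<omega> a"
        unfolding F_def A_def p_def by (rule cond_act) simp
      ultimately show "AE \<omega> in M.
          real_cond_exp M (F t) (\<lambda>\<omega>. ((c t \<omega> a)\<^sup>2 * R_max\<^sup>2) * indicator (A t a) \<omega>) \<omega>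
          = (c t \<omega> a)\<^sup>2 * R_max\<^sup>2 * p t \<omega> a"
        by eventually_elim simp
    qed simp
    from 1 2 3 show ?thesis by eventually_elim (simp add: v_eq)
  qed
  show ?thesis
  proof (rule AE_drift_two_sided_bound[where F = F and B = "L * R_max"
        and C = "\<Sum>a\<in>UNIV. L * \<bar>mean_reward P a\<bar>"])
    show "\<mu> t \<in> borel_measurable (F t)" for t
      unfolding \<mu>_eq[abs_def] by measurable
    show "v t \<in> borel_measurable (F t)" for t
      unfolding v_eq[abs_def] by measurable
    show "0 \<le> v t \<omega>" for t \<omega>
      unfolding v_eq using p01 by (intro sum_nonneg mult_nonneg_nonneg) auto
  qed (rule sub filt D_F bound \<mu>_bound first second prob_space_axioms)+
qed

end

section \<open>From the dichotomy to convergence of the policies\<close>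

theorem theorem11:
  fixes M :: "'w measure"
    and P :: "'k::{finite,linorder} \<Rightarrow> real measure"
    and \<nu> :: "real measure"
    and X :: "real^'d^'k::{finite,linorder}"
    and R_max \<eta> :: real
    and \<theta>\<^sub>1 :: "real^'d"
    and act :: "nat \<Rightarrow> 'w \<Rightarrow> 'k"
    and rew :: "nat \<Rightarrow> 'w \<Rightarrow> real"
    and \<theta> :: "nat \<Rightarrow> 'w \<Rightarrow> real^'d"
  assumes "R_max > 0"
    and "reward_model R_max \<nu> P"
    and "\<And>a b. a < b \<Longrightarrow> mean_reward P a > mean_reward P b"
    and "CARD('d) \<le> CARD('k)"
    and "feature_condition (mean_reward P) X"
    and "\<eta> > 0"
    and "softmax_pg_process M P X \<eta> \<theta>\<^sub>1 act rew \<theta>"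
  shows "AE \<omega> in M. (\<lambda>t. policy X (\<theta> t \<omega>) $ first_action) \<longlonglongrightarrow> 1"
proof -
  interpret prob_space M using assms(7) by (simp add: softmax_pg_process_def)
  interpret softmax_pg M P \<nu> X R_max \<eta> \<theta>\<^sub>1 act rew \<theta>
    by unfold_locales fact+
  define best where "best = (first_action :: 'k)"
  have best_le: "best \<le> a" for a
    by (simp add: best_def first_action_def)
  define r where "r = mean_reward P"
  have r: "r a > r b" if "a < b" for a b using assms(3) that by (simp add: r_def)
  define u where "u k = X $ best - X $ k" for k
  \<comment> \<open>Differences of \<open>y k\<close> are the inner products of the feature
    condition with third action \<open>k\<close>.\<close>
  define y where "y k a = X $ a \<bullet> u k" for k a
  define p where "p \<omega> t a = policy X (\<theta> (Suc t) \<omega>) $ a" for \<omega> t a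
  define H where "H k \<omega> t = (\<Sum>i\<in>UNIV. \<Sum>j\<in>UNIV. p \<omega> t i * p \<omega> t j * ((r i - r j) * (y k i - y k j)))" for k \<omega> t
  define S where "S k \<omega> t = (\<Sum>i\<in>UNIV. \<Sum>j\<in>UNIV. p \<omega> t i * p \<omega> t j * (y k i - y k j)\<^sup>2)" for k \<omega> t
  define D where "D k \<omega> t = u k \<bullet> \<theta> (Suc t) \<omega>" for k \<omega> t
  have p: "p \<omega> t a > 0" and sum_p: "(\<Sum>a\<in>UNIV. p \<omega> t a) = 1" for \<omega> t a
    by (simp_all add: p_def policy_pos sum_policy)
  \<comment> \<open>The actions are finitely many, so one null set serves all directions; the rest
    of the argument fixes \<omega>.\<close>
  have "AE \<omega> in M. \<forall>k\<in>UNIV. \<forall>\<epsilon>>0. \<exists>K. \<forall>t. \<bar>D k \<omega> t - D k \<omega> 0 - (\<Sum>s<t. \<eta> / 2 * H k \<omega> s)\<bar>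
      \<le> \<epsilon> * (\<Sum>s<t. \<eta>\<^sup>2 * R_max\<^sup>2 / 2 * S k \<omega> s) + K"
  proof (rule AE_finite_allI)
    fix k
    have \<mu>_eq: "(let p = policy X (\<theta> (Suc t) \<omega>) in
        \<eta> * (\<Sum>a\<in>UNIV. p $ a * mean_reward P a * (X $ a \<bullet> u k - (\<Sum>b\<in>UNIV. p $ b * (X $ b \<bullet> u k)))))
      = \<eta> / 2 * H k \<omega> t" for t \<omega>
      using weighted_covariance_eq[OF sum_p[of \<omega> t], of r "y k"]
      by (simp add: Let_def H_def p_def y_def r_def)
    have v_eq: "(let p = policy X (\<theta> (Suc t) \<omega>) in
        \<eta>\<^sup>2 * R_max\<^sup>2 * (\<Sum>a\<in>UNIV. p $ a * (X $ a \<bullet> u k - (\<Sum>b\<in>UNIV. p $ b * (X $ b \<bullet> u k)))\<^sup>2))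
      = \<eta>\<^sup>2 * R_max\<^sup>2 / 2 * S k \<omega> t" for t \<omega>
      using weighted_variance_eq[OF sum_p[of \<omega> t], of "y k"]
      by (simp add: Let_def S_def p_def y_def)
    show "AE \<omega> in M. \<forall>\<epsilon>>0. \<exists>K. \<forall>t. \<bar>D k \<omega> t - D k \<omega> 0 - (\<Sum>s<t. \<eta> / 2 * H k \<omega> s)\<bar>
      \<le> \<epsilon> * (\<Sum>s<t. \<eta>\<^sup>2 * R_max\<^sup>2 / 2 * S k \<omega> s) + K"
      using AE_direction_concentration[of "u k"] unfolding \<mu>_eq v_eq D_def .
  qed simp
  then show ?thesis
  proof eventually_elim
    case (elim \<omega>)
    have dichotomy: "summable (\<lambda>t. p \<omega> t k) \<or> (\<lambda>t. p \<omega> t k / p \<omega> t best) \<longlonglongrightarrow> 0" if "best \<noteq> k" for k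
      using that
    \<comment> \<open>Larger actions are worse, so the induction starts from the worst one and moves
      towards the best.\<close>
    proof (induction "card {k<..}" arbitrary: k rule: less_induct)
      case less
      have ge: "y k i \<ge> y k j" if "i < j" "i < k" for i j
      proof -
        have "if i = best \<or> j = k then (X $ i - X $ j) \<bullet> u k > 0 else (X $ i - X $ j) \<bullet> u k \<ge> 0"
          using assms(5) r[OF that(1)] r[OF that(2)]
          unfolding feature_condition_def r_def[symmetric] u_def best_def by blast
        then show ?thesis
          unfolding y_def inner_diff_left by (simp split: if_splits)
      qed
      have gt: "y k best > y k j" if "j \<noteq> best" for j
      proof -
        have "best < j" "best < k" using best_le[of j] best_le[of k] that less.prems by auto
        from r[OF this(1)] r[OF this(2)] have "(X $ best - X $ j) \<bullet> u k > 0"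
          using assms(5) unfolding feature_condition_def r_def[symmetric] u_def best_def by presburger
        then show ?thesis
          unfolding y_def inner_diff_left by simp
      qed
      obtain \<alpha> \<gamma> C where pos: "\<alpha> > 0" "\<gamma> > 0" "C > 0"
        and lower: "\<And>p. (\<And>a. p a \<ge> 0) \<Longrightarrow> (\<Sum>a\<in>UNIV. p a) = 1 \<Longrightarrow>
          \<alpha> * (\<Sum>i\<in>UNIV. \<Sum>j\<in>UNIV. p i * p j * (y k i - y k j)\<^sup>2) - \<gamma> * ((1 - p best) * (\<Sum>j | k < j. p j))
            \<le> (\<Sum>i\<in>UNIV. \<Sum>j\<in>UNIV. p i * p j * ((r i - r j) * (y k i - y k j)))"
        and upper: "\<And>p. (\<And>a. p a \<ge> 0) \<Longrightarrow> (\<Sum>a\<in>UNIV. p a) = 1 \<Longrightarrow>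
          \<bar>\<Sum>i\<in>UNIV. \<Sum>j\<in>UNIV. p i * p j * ((r i - r j) * (y k i - y k j))\<bar>
            \<le> C * (\<Sum>i\<in>UNIV. \<Sum>j\<in>UNIV. p i * p j * (y k i - y k j)\<^sup>2)"
        and var: "\<And>p. (\<And>a. p a \<ge> 0) \<Longrightarrow> (\<Sum>a\<in>UNIV. p a) = 1 \<Longrightarrow>
          p best * (1 - p best) \<le> C * (\<Sum>i\<in>UNIV. \<Sum>j\<in>UNIV. p i * p j * (y k i - y k j)\<^sup>2)"
        by (rule covariance_dominates_variance[of r best k "y k", OF r best_le less.prems ge gt]) blast+
      define \<tau> where "\<tau> = \<eta>\<^sup>2 * R_max\<^sup>2 / 2"
      have \<tau>: "\<tau> > 0" using assms(1,6) by (simp add: \<tau>_def)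
      have p0: "p \<omega> t a \<ge> 0" for t a using p[of \<omega> t a] by simp
      have lower': "\<alpha> * S k \<omega> t - \<gamma> * ((1 - p \<omega> t best) * (\<Sum>j | k < j. p \<omega> t j)) \<le> H k \<omega> t"
        and upper': "\<bar>H k \<omega> t\<bar> \<le> C * S k \<omega> t"
        and var': "p \<omega> t best * (1 - p \<omega> t best) \<le> C * S k \<omega> t" for t
        unfolding S_def H_def using lower upper var p0 sum_p by blast+
      have S0: "S k \<omega> t \<ge> 0" for t
        unfolding S_def using p0 by (intro sum_nonneg mult_nonneg_nonneg) auto
      show ?case
      \<comment> \<open>The constants are rescaled because the drift is \<open>\<eta> / 2\<close>
        times \<open>H\<close> and the variance is \<tau> times \<open>S\<close>. The factor
        \<open>\<eta> / 2 + 1\<close> covers the drift bound and the bound of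
        \<open>p best * (1 - p best)\<close> at once.\<close>
      proof (rule summable_or_ratio_tendsto_0[where p = "p \<omega>" and best = best and k = k
            and D = "D k \<omega>" and \<mu> = "\<lambda>t. \<eta> / 2 * H k \<omega> t" and v = "\<lambda>t. \<tau> * S k \<omega> t"
            and \<alpha> = "\<eta> / 2 * \<alpha> / \<tau>" and \<gamma> = "\<eta> / 2 * \<gamma>" and C = "(\<eta> / 2 + 1) * C / \<tau>"])
        show "p \<omega> t k = p \<omega> t best * exp (- D k \<omega> t)" for t
          unfolding p_def D_def u_def by (rule policy_ratio)
        show "\<eta> / 2 * \<alpha> / \<tau> * (\<tau> * S k \<omega> t)
            - \<eta> / 2 * \<gamma> * ((1 - p \<omega> t best) * (\<Sum>j | k < j. p \<omega> t j)) \<le> \<eta> / 2 * H k \<omega> t" for t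
          using mult_left_mono[OF lower'[of t], of "\<eta> / 2"] assms(6) \<tau> by (simp add: algebra_simps)
        show "\<bar>\<eta> / 2 * H k \<omega> t\<bar> \<le> (\<eta> / 2 + 1) * C / \<tau> * (\<tau> * S k \<omega> t)" for t
        proof -
          have "\<bar>\<eta> / 2 * H k \<omega> t\<bar> = \<eta> / 2 * \<bar>H k \<omega> t\<bar>" using assms(6) by (simp add: abs_mult)
          also have "\<dots> \<le> (\<eta> / 2 + 1) * (C * S k \<omega> t)"
            using assms(6) by (intro mult_mono upper') auto
          finally show ?thesis using \<tau> by simp
        qed
        show "p \<omega> t best * (1 - p \<omega> t best) \<le> (\<eta> / 2 + 1) * C / \<tau> * (\<tau> * S k \<omega> t)" for t
        proof -
          have "1 * (C * S k \<omega> t) \<le> (\<eta> / 2 + 1) * (C * S k \<omega> t)"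
            using assms(6) pos S0[of t] by (intro mult_right_mono) auto
          then show ?thesis using var'[of t] \<tau> by simp
        qed
        show "\<exists>K. \<forall>t. \<bar>D k \<omega> t - D k \<omega> 0 - (\<Sum>s<t. \<eta> / 2 * H k \<omega> s)\<bar>
            \<le> \<epsilon> * (\<Sum>s<t. \<tau> * S k \<omega> s) + K" if "\<epsilon> > 0" for \<epsilon>
          using elim that unfolding \<tau>_def by blast
        show "summable (\<lambda>t. p \<omega> t j) \<or> (\<lambda>t. p \<omega> t j / p \<omega> t best) \<longlonglongrightarrow> 0" if "k < j" for j
        proof (rule less.hyps)
          show "card {j<..} < card {k<..}"
            using that by (intro psubset_card_mono) auto
          show "best \<noteq> j" using best_le[of k] that by auto
        qed
      qed (use p sum_p pos assms(6) \<tau> less.prems in auto)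
    qed
    have "(\<lambda>t. p \<omega> t k) \<longlonglongrightarrow> 0" if "best \<noteq> k" for k
      using dichotomy[OF that]
    proof
      assume "(\<lambda>t. p \<omega> t k / p \<omega> t best) \<longlonglongrightarrow> 0"
      then show ?thesis
      proof (rule Lim_null_comparison[rotated], intro always_eventually allI)
        fix t
        \<comment> \<open>As \<open>p \<omega> t best\<close> is at most 1, the probability of
          \<open>k\<close> is dominated by its ratio to that of \<open>best\<close>.\<close>
        have "p \<omega> t k * p \<omega> t best \<le> p \<omega> t k"
          using p[of \<omega> t k] policy_le_1[of X "\<theta> (Suc t) \<omega>" best] by (simp add: p_def)
        then show "norm (p \<omega> t k) \<le> p \<omega> t k / p \<omega> t best"
          using p[of \<omega> t k] p[of \<omega> t best] by (simp add: field_simps)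
      qed
    qed (rule summable_LIMSEQ_zero)
    then have "(\<lambda>t. 1 - (\<Sum>k\<in>UNIV - {best}. p \<omega> t k)) \<longlonglongrightarrow> 1 - (\<Sum>k\<in>UNIV - {best}. 0)"
      by (intro tendsto_diff tendsto_sum tendsto_const) auto
    moreover have "1 - (\<Sum>k\<in>UNIV - {best}. p \<omega> t k) = policy X (\<theta> (Suc t) \<omega>) $ first_action" for t
      using sum_p[of \<omega> t] sum.remove[of UNIV best "p \<omega> t"] by (simp add: p_def best_def)
    ultimately have "(\<lambda>t. policy X (\<theta> (Suc t) \<omega>) $ first_action) \<longlonglongrightarrow> 1"
      by simp
    \<comment> \<open>Undoes the time shift in \<open>p\<close>, which is indexed from
      \<open>Suc t\<close>.\<close>
    then show ?case by (rule LIMSEQ_imp_Suc)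
  qed
qed

end
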